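(* Let $A$ be an unbounded nonnegative discrete multiplication operator on a Hilbert space $\mathcal{H}$, with eigenbasis $\{e_i\}$ and eigenvalues $\lambda_i^2$. Let $\mu_1,\mu_2,\alpha,H$ be real numbers with $0<\mu_1<\mu_2$, $\alpha\in(0,1)$, $H>0$. Let $\delta,\sigma,s,S$ be real numbers with $$0\le\delta<\frac{H}{32\,\mu_2^{(1+\alpha)/2}},\qquad 2\sigma=1-\alpha,\qquad s=S=\frac{1}{1-\alpha}.$$ Then the set of propagation speeds $c\in\mathcal{PS}(\mu_1,\mu_2,\alpha,H)$ for which the equation $u''+2\delta A^{\sigma}u'+c(t)Au=0$ admits a very weak solution $u$ satisfying $$(u(0),u'(0))\in\mathcal{G}_{s,\log,1/2}(A)\times\mathcal{G}_{s,\log,0}(A)$$ and $$(u(t),u'(t))\notin\mathcal{G}_{-S,\log,1/2}(A)\times\mathcal{G}_{-S,\log,0}(A)\qquad\forall t>0$$ is residual in $\mathcal{PS}(\mu_1,\mu_2,\alpha,H)$ with respect to the distance induced by the uniform ($L^\infty$) norm.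
   Context: A nonnegative discrete multiplication operator $A$ on a Hilbert space $\mathcal{H}$ is given by an orthonormal basis $\{e_i\}_{i\in\mathbb{N}}$ and a nondecreasing sequence $\{\lambda_i\}$ of nonnegative reals with $Ae_i=\lambda_i^2e_i$; it is unbounded if $\lambda_i\to+\infty$. Elements are identified with coefficient sequences $u=\{u_i\}$, and the following spaces of sequences are used ($\beta\in\mathbb{R}$, $s,S>0$): - $u\in\mathcal{G}_{s,\log,\beta}(A)$ iff $\sum_i u_i^2(1+\lambda_i)^{4\beta}\exp\!\big(2\lambda_i^{1/s}/\log(2+\lambda_i)\big)<+\infty$; - $u\in\mathcal{G}_{-S,\log,\beta}(A)$ iff $\sum_i u_i^2(1+\lambda_i)^{4\beta}\exp\!\big(-2\lambda_i^{1/S}/\log(2+\lambda_i)\big)<+\infty$. For $0<\mu_1<\mu_2$, $\alpha\in(0,1)$, $H>0$, $\mathcal{PS}(\mu_1,\mu_2,\alpha,H)$ is the set of functions $c:[0,+\infty)\to[0,+\infty)$ with $\mu_1\le c(t)\le\mu_2$ for all $t\ge0$ and $|c(t)-c(s)|\le H|t-s|^\alpha$ for all $t,s\ge 0$; it is a complete metric space with the uniform distance. A subset of a complete metric space is residual if it contains a countable intersection of open dense sets. A very weak solution of $u''+2\delta A^\sigma u'+c(t)Au=0$ is a sequence $\{u_i(t)\}$ of $C^2$ functions on $[0,+\infty)$ with $u_i''(t)+2\delta\lambda_i^{2\sigma}u_i'(t)+c(t)\lambda_i^2u_i(t)=0$ for every $i$ and $t\ge 0$; one writes $u(t)=\{u_i(t)\}$,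 $u'(t)=\{u_i'(t)\}$. *)

theory Defs
  imports "HOL-Analysis.Analysis"
begin

text \<open>A nonnegative discrete multiplication operator A is encoded by the
sequence lam of square roots of its eigenvalues (A e_i = lam_i^2 e_i);
elements of the Hilbert space are identified with coefficient sequences.\<close>

definition unbounded_discrete_mult_op :: "(nat \<Rightarrow> real) \<Rightarrow> bool" where
  "unbounded_discrete_mult_op lam \<longleftrightarrow>
     (\<forall>i. 0 \<le> lam i) \<and> mono lam \<and> filterlim lam at_top sequentially"

definition G_pos :: "(nat \<Rightarrow> real) \<Rightarrow> real \<Rightarrow> real \<Rightarrow> (nat \<Rightarrow> real) set" where
  "G_pos lam s \<beta> = {u. summable (\<lambda>i. (u i)\<^sup>2 * (1 + lam i) powr (4 * \<beta>)
       * exp (2 * lam i powr (1 / s) / ln (2 + lam i)))}"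

definition G_neg :: "(nat \<Rightarrow> real) \<Rightarrow> real \<Rightarrow> real \<Rightarrow> (nat \<Rightarrow> real) set" where
  "G_neg lam S \<beta> = {u. summable (\<lambda>i. (u i)\<^sup>2 * (1 + lam i) powr (4 * \<beta>)
       * exp (- 2 * lam i powr (1 / S) / ln (2 + lam i)))}"

definition PS :: "real \<Rightarrow> real \<Rightarrow> real \<Rightarrow> real \<Rightarrow> (real \<Rightarrow> real) set" where
  "PS \<mu>1 \<mu>2 \<alpha> H = {c. (\<forall>t\<ge>0. \<mu>1 \<le> c t \<and> c t \<le> \<mu>2) \<and>
       (\<forall>t\<ge>0. \<forall>s\<ge>0. \<bar>c t - c s\<bar> \<le> H * \<bar>t - s\<bar> powr \<alpha>)}"

definition unif_dist :: "(real \<Rightarrow> real) \<Rightarrow> (real \<Rightarrow> real) \<Rightarrow> real" where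
  "unif_dist c1 c2 = (SUP t\<in>{0..}. \<bar>c1 t - c2 t\<bar>)"

definition open_in_space :: "(real \<Rightarrow> real) set \<Rightarrow> (real \<Rightarrow> real) set \<Rightarrow> bool" where
  "open_in_space X U \<longleftrightarrow> U \<subseteq> X \<and>
     (\<forall>c\<in>U. \<exists>\<epsilon>>0. \<forall>c'\<in>X. unif_dist c c' < \<epsilon> \<longrightarrow> c' \<in> U)"

definition dense_in_space :: "(real \<Rightarrow> real) set \<Rightarrow> (real \<Rightarrow> real) set \<Rightarrow> bool" where
  "dense_in_space X U \<longleftrightarrow> (\<forall>c\<in>X. \<forall>\<epsilon>>0. \<exists>c'\<in>U. unif_dist c c' < \<epsilon>)"

definition residual_in :: "(real \<Rightarrow> real) set \<Rightarrow> (real \<Rightarrow> real) set \<Rightarrow> bool" where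
  "residual_in X R \<longleftrightarrow> R \<subseteq> X \<and>
     (\<exists>U :: nat \<Rightarrow> (real \<Rightarrow> real) set.
        (\<forall>n. open_in_space X (U n) \<and> dense_in_space X (U n)) \<and> (\<Inter>n. U n) \<subseteq> R)"

definition very_weak_solution ::
  "(nat \<Rightarrow> real) \<Rightarrow> real \<Rightarrow> real \<Rightarrow> (real \<Rightarrow> real) \<Rightarrow>
   (nat \<Rightarrow> real \<Rightarrow> real) \<Rightarrow> (nat \<Rightarrow> real \<Rightarrow> real) \<Rightarrow> bool" where
  "very_weak_solution lam \<delta> \<sigma> c u u' \<longleftrightarrow>
     (\<forall>i. \<exists>u'' :: real \<Rightarrow> real.
        continuous_on {0..} u'' \<and>
        (\<forall>t\<ge>0. (u i has_real_derivative u' i t) (at t within {0..}) \<and>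
                (u' i has_real_derivative u'' t) (at t within {0..}) \<and>
                u'' t + 2 * \<delta> * lam i powr (2 * \<sigma>) * u' i t
                  + c t * (lam i)\<^sup>2 * u i t = 0))"

end

theory Submission
  imports Defs "HOL-Real_Asymp.Real_Asymp"
begin

text \<open>For a frequency \<open>l\<close>, the function \<open>u = sin (l \<Phi>) e\<^sup>b\<close> with \<open>\<Phi>' = w\<close> and
  \<open>b' = - D - w' / (2 w) + \<kappa> sin\<^sup>2 (l \<Phi>)\<close> solves \<open>u'' + 2 D u' + c l\<^sup>2 u = 0\<close> exactly, for a speed \<open>c\<close>
  that differs from \<open>w\<^sup>2\<close> by an oscillation of amplitude about \<open>\<kappa> / l\<close> and frequency \<open>2 l w\<close>.
  With \<open>D = \<delta> l powr (1 - \<alpha>)\<close> and \<open>\<kappa> = k l powr (1 - \<alpha>)\<close> the \<open>\<alpha>\<close>-Hoelder constant of this oscillation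
  stays bounded by a multiple of \<open>k\<close>, while \<open>u\<close> grows like \<open>exp ((k / 2 - \<delta>) l powr (1 - \<alpha>) t)\<close>;
  the smallness of \<open>\<delta>\<close> leaves room for \<open>k > 2 \<delta>\<close>. A smooth \<open>w\<^sup>2\<close> is Lipschitz at small scales
  and the oscillation is uniformly small, so their Hoelder constants do not add up, and every admissible
  speed can be approximated by such a \<open>c\<close>.

  The fundamental solution at frequency \<open>l\<close> depends continuously on \<open>c\<close>. Hence the speeds whose
  fundamental solution at some frequency beyond \<open>n\<close> exceeds
  \<open>(1 + l) exp (2 l powr (1 - \<alpha>) / ln (2 + l))\<close> throughout \<open>[1 / (n + 1), n + 1]\<close> form an open dense set.
  For a speed in all these sets, a series of rescaled fundamental solutions is the required solution.\<close>

section \<open>The scalar linear equation\<close>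

text \<open>Infinite endpoints in the open-interval theorem give two-sided derivatives on the whole
  line; subtracting the value at 0 normalises the primitive.\<close>

lemma antiderivative_real_line:
  fixes f :: "real \<Rightarrow> 'a::euclidean_space"
  assumes "continuous_on UNIV f"
  shows "\<exists>F. F 0 = 0 \<and> (\<forall>t. (F has_vector_derivative f t) (at t))"
proof -
  have "\<exists>F. \<forall>x::real. (-\<infinity>::ereal) < x \<longrightarrow> x < (\<infinity>::ereal) \<longrightarrow> (F has_vector_derivative f x) (at x)"
    using assms by (intro einterval_antiderivative) (auto simp: continuous_on_eq_continuous_at)
  then obtain F where F: "\<And>x. (F has_vector_derivative f x) (at x)" by auto
  have "((\<lambda>t. F t - F 0) has_vector_derivative f t - 0) (at t)" for t
    by (intro has_vector_derivative_diff F has_vector_derivative_const)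
  then show ?thesis by (intro exI[of _ "\<lambda>t. F t - F 0"]) auto
qed

lemma antiderivative_real:
  fixes f :: "real \<Rightarrow> real"
  assumes "continuous_on UNIV f"
  obtains F where "F 0 = 0" "\<And>t. (F has_real_derivative f t) (at t)"
  using antiderivative_real_line[OF assms]
  by (auto simp: has_real_derivative_iff_has_vector_derivative)

text \<open>Picard iteration, contractive on \<open>[0, \<infinity>)\<close> in the sup norm weighted by \<open>exp (- 2 K t)\<close>.\<close>

lemma linear_ode_solution:
  fixes A :: "real \<Rightarrow> 'a::euclidean_space \<Rightarrow> 'a" and x0 :: 'a
  assumes lin: "\<And>t. linear (A t)"
    and bnd: "\<And>t x. norm (A t x) \<le> K * norm x"
    and K: "0 < K"
    and cont: "\<And>w. continuous_on UNIV w \<Longrightarrow> continuous_on UNIV (\<lambda>t. A t (w t))"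
  obtains w where "w 0 = x0" "\<And>t. 0 \<le> t \<Longrightarrow> (w has_vector_derivative A t (w t)) (at t)"
proof -
  \<comment> \<open>The weight exponent \<open>L\<close> against the operator bound \<open>K\<close>
    yields the contraction factor \<open>K / L = 1 / 2\<close>.\<close>
  define L where "L = 2 * K"
  have L: "0 < L" using K by (simp add: L_def)
  \<comment> \<open>The unknown is the rescaled function
    \<open>f t = exp (- L * t) *\<^sub>R w t\<close>; \<open>I f\<close> is the integral of the
    Picard map expressed through \<open>f\<close>.\<close>
  define I where "I f = (SOME F. F 0 = 0 \<and>
      (\<forall>t. (F has_vector_derivative A t (exp (L * t) *\<^sub>R apply_bcontfun f t)) (at t)))" for f :: "real \<Rightarrow>\<^sub>C 'a"
  have I: "I f 0 = 0 \<and> (\<forall>t. (I f has_vector_derivative A t (exp (L * t) *\<^sub>R f t)) (at t))" for f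
  proof -
    have "continuous_on UNIV (\<lambda>t. exp (L * t) *\<^sub>R f t)" by (intro continuous_intros) auto
    from someI_ex[OF antiderivative_real_line[OF cont[OF this]]] show ?thesis
      unfolding I_def by simp
  qed
  have I_cont: "continuous_on X (I f)" for f X
    by (meson I continuous_at_imp_continuous_on has_vector_derivative_continuous)
  have I_diff: "norm (I f t - I g t) \<le> dist f g / 2 * exp (L * t)" if t: "0 \<le> t" for f g t
  proof (cases "t = 0")
    case True then show ?thesis using I[of f] I[of g] by simp
  next
    case False
    \<comment> \<open>\<open>\<phi>\<close> is a primitive of
      \<open>K * exp (L * s) * dist f g\<close>, which bounds the derivative of
      \<open>I f - I g\<close>.\<close>
    define \<phi> where "\<phi> s = dist f g / 2 * exp (L * s)" for s
    have "norm ((I f t - I g t) - (I f 0 - I g 0)) \<le> \<phi> t - \<phi> 0"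
    proof (rule differentiable_bound_general[where f="\<lambda>s. I f s - I g s" and \<phi>=\<phi>
         and f'="\<lambda>s. A s (exp (L * s) *\<^sub>R f s) - A s (exp (L * s) *\<^sub>R g s)"
         and \<phi>'="\<lambda>s. dist f g / 2 * (L * exp (L * s))"])
      show "0 < t" using t False by simp
      show "continuous_on {0..t} (\<lambda>s. I f s - I g s)" by (intro continuous_intros I_cont)
      show "continuous_on {0..t} \<phi>" unfolding \<phi>_def by (intro continuous_intros)
      show "((\<lambda>s. I f s - I g s) has_vector_derivative
             A s (exp (L * s) *\<^sub>R f s) - A s (exp (L * s) *\<^sub>R g s)) (at s)" for s
        by (intro has_vector_derivative_diff) (use I in auto)
      show "(\<phi> has_vector_derivative dist f g / 2 * (L * exp (L * s))) (at s)" for s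
        unfolding \<phi>_def has_real_derivative_iff_has_vector_derivative[symmetric]
        by (auto intro!: derivative_eq_intros)
      show "norm (A s (exp (L * s) *\<^sub>R f s) - A s (exp (L * s) *\<^sub>R g s))
            \<le> dist f g / 2 * (L * exp (L * s))" for s
      proof -
        have "A s (exp (L * s) *\<^sub>R f s) - A s (exp (L * s) *\<^sub>R g s) = A s (exp (L * s) *\<^sub>R (f s - g s))"
          by (simp add: linear_diff[OF lin] scaleR_diff_right)
        also have "norm \<dots> \<le> K * (exp (L * s) * norm (f s - g s))"
          using bnd[of s "exp (L * s) *\<^sub>R (f s - g s)"] by simp
        also have "\<dots> \<le> K * (exp (L * s) * dist f g)"
          using K dist_bounded[of f s g] by (simp add: dist_norm)
        finally show ?thesis by (simp add: L_def algebra_simps)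
      qed
    qed
    moreover have "\<phi> 0 \<ge> 0" by (simp add: \<phi>_def)
    moreover have "I f 0 - I g 0 = 0" using I[of f] I[of g] by simp
    ultimately have "norm (I f t - I g t) \<le> \<phi> t" by simp
    then show ?thesis by (simp only: \<phi>_def)
  qed
  \<comment> \<open>Freezing time at 0 for negative \<open>t\<close> lets \<open>P f\<close> live in
    the complete space of bounded continuous functions on the whole line.\<close>
  define P where "P f t = exp (- (L * max t 0)) *\<^sub>R (x0 + I f (max t 0))" for f t
  \<comment> \<open>For \<open>f = 0\<close> the integrand vanishes. Hence \<open>P 0\<close> is
    bounded by \<open>norm x0\<close>, and \<open>P_diff\<close> carries boundedness over to every
    \<open>P f\<close>.\<close>
  have I_0: "I 0 t = 0" if "0 \<le> t" for t
  proof -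
    have "(I 0 has_vector_derivative 0) (at s within {0..t})" for s
      using I[of 0] linear_0[OF lin] by (auto intro: has_vector_derivative_at_within)
    then show ?thesis using has_vector_derivative_zero_constant[of "{0..t}" "I 0"] I[of 0] that
      by (metis atLeastAtMost_iff convex_real_interval(5) order_refl)
  qed
  have P_diff: "norm (P f t - P g t) \<le> dist f g / 2" for f g t
  proof -
    have "norm (P f t - P g t) = exp (- (L * max t 0)) * norm (I f (max t 0) - I g (max t 0))"
      by (simp add: P_def scaleR_diff_right[symmetric])
    also have "\<dots> \<le> exp (- (L * max t 0)) * (dist f g / 2 * exp (L * max t 0))"
      by (intro mult_left_mono I_diff) auto
    also have "\<dots> = dist f g / 2" by (simp add: exp_minus)
    finally show ?thesis .
  qed
  have P_bcontfun: "P f \<in> bcontfun" for f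
  proof (rule bcontfun_normI)
    show "continuous_on UNIV (P f)" unfolding P_def
      by (intro continuous_intros continuous_on_compose2[OF I_cont[of UNIV f]]) auto
    fix t
    have "norm (P 0 t) \<le> norm x0" using L by (simp add: P_def I_0 mult_left_le_one_le)
    then show "norm (P f t) \<le> norm x0 + dist f 0 / 2"
      using P_diff[of f t 0] norm_triangle_sub[of "P f t" "P 0 t"] by linarith
  qed
  define T where "T f = Bcontfun (P f)" for f
  have T: "apply_bcontfun (T f) = P f" for f
    unfolding T_def using P_bcontfun by (rule Bcontfun_inverse)
  have "dist (T f) (T g) \<le> 1 / 2 * dist f g" for f g
    using P_diff[of f _ g] by (intro dist_bound) (simp add: T dist_norm)
  then have "\<exists>!f. T f = f"
    by (intro banach_fix_type[of "1/2"]) auto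
  then obtain f where f: "T f = f" by auto
  define w where "w t = x0 + I f t" for t
  show ?thesis
  proof (rule that[of w])
    show "w 0 = x0" using I[of f] by (simp add: w_def)
    fix t :: real assume t: "0 \<le> t"
    have "exp (L * t) *\<^sub>R f t = exp (L * t) *\<^sub>R P f t" using f T by metis
    also have "\<dots> = w t" using t by (simp add: P_def w_def exp_minus)
    finally have "(I f has_vector_derivative A t (w t)) (at t)" using I[of f] by metis
    then have "(w has_vector_derivative 0 + A t (w t)) (at t)"
      unfolding w_def by (intro has_vector_derivative_add has_vector_derivative_const)
    then show "(w has_vector_derivative A t (w t)) (at t)" by simp
  qed
qed

text \<open>The fundamental solution of \<open>u'' + a u' + c u = 0\<close> with the initial data of
  the sine. Here \<open>c\<close> is the full zero-order coefficient, so it will carry the factor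
  \<open>l\<^sup>2\<close>. The derivative at 0 is one-sided, as in
  \<open>very_weak_solution\<close>.\<close>

definition sine_like_solution :: "real \<Rightarrow> (real \<Rightarrow> real) \<Rightarrow> (real \<Rightarrow> real) \<Rightarrow> (real \<Rightarrow> real) \<Rightarrow> bool" where
  "sine_like_solution a c u u' \<longleftrightarrow> u 0 = 0 \<and> u' 0 = 1 \<and>
     (\<forall>t\<ge>0. (u has_real_derivative u' t) (at t within {0..}) \<and>
            (u' has_real_derivative - a * u' t - c t * u t) (at t within {0..}))"

lemma sine_like_solution_exists:
  assumes cont: "continuous_on {0..} c" and bnd: "\<And>t. 0 \<le> t \<Longrightarrow> \<bar>c t\<bar> \<le> B"
  obtains u u' where "sine_like_solution a c u u'"
proof -
  \<comment> \<open>The linear system is posed on the whole line, so \<open>c\<close> is extended by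
    its value at 0.\<close>
  define C where "C t = c (max t 0)" for t
  have C: "continuous_on UNIV C"
    unfolding C_def by (rule continuous_on_compose2[OF cont]) (auto intro!: continuous_intros)
  have CB: "\<bar>C t\<bar> \<le> B" for t unfolding C_def by (rule bnd) auto
  define M where "M t x = (snd x, - a * snd x - C t * fst x)" for t and x :: "real \<times> real"
  have lin: "linear (M t)" for t
    by (rule linearI) (auto simp: M_def algebra_simps)
  have M_le: "norm (M t x) \<le> (1 + \<bar>a\<bar> + B) * norm x" for t x
  proof -
    have f: "\<bar>fst x\<bar> \<le> norm x" "\<bar>snd x\<bar> \<le> norm x"
      using norm_fst_le[of "fst x" "snd x"] norm_snd_le[of "snd x" "fst x"] by auto
    have "norm (M t x) \<le> \<bar>snd x\<bar> + \<bar>- a * snd x - C t * fst x\<bar>"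
      unfolding M_def using norm_Pair_le[of "snd x" "- a * snd x - C t * fst x"] by simp
    also have "\<bar>- a * snd x - C t * fst x\<bar> \<le> \<bar>a\<bar> * \<bar>snd x\<bar> + \<bar>C t\<bar> * \<bar>fst x\<bar>"
      by (simp add: abs_mult[symmetric])
    also have "\<bar>a\<bar> * \<bar>snd x\<bar> + \<bar>C t\<bar> * \<bar>fst x\<bar> \<le> \<bar>a\<bar> * norm x + B * norm x"
      using f CB[of t] by (intro add_mono mult_mono) auto
    also note f(2)
    finally show ?thesis by (simp add: algebra_simps)
  qed
  have "0 \<le> B" using bnd[of 0] by simp
  then have pos: "0 < 1 + \<bar>a\<bar> + B" by simp
  have M_cont: "continuous_on UNIV (\<lambda>t. M t (w t))" if "continuous_on UNIV w" for w
    unfolding M_def using that C by (auto intro!: continuous_intros)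
  obtain w where w: "w 0 = (0, 1)"
      "\<And>t. 0 \<le> t \<Longrightarrow> (w has_vector_derivative M t (w t)) (at t)"
    by (rule linear_ode_solution[OF lin M_le pos M_cont, of "(0, 1)"]) auto
  have "sine_like_solution a c (\<lambda>t. fst (w t)) (\<lambda>t. snd (w t))"
    unfolding sine_like_solution_def
  proof (intro conjI allI impI)
    fix t :: real assume t: "0 \<le> t"
    have d: "(w has_derivative (\<lambda>h. h *\<^sub>R M t (w t))) (at t)"
      using w(2)[OF t] by (simp add: has_vector_derivative_def)
    have "((\<lambda>t. fst (w t)) has_real_derivative fst (M t (w t))) (at t)"
      using has_derivative_fst[OF d] by (simp add: has_field_derivative_def mult_commute_abs)
    then show "((\<lambda>t. fst (w t)) has_real_derivative snd (w t)) (at t within {0..})"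
      by (auto simp: M_def intro: has_field_derivative_at_within)
    have "((\<lambda>t. snd (w t)) has_real_derivative snd (M t (w t))) (at t)"
      using has_derivative_snd[OF d] by (simp add: has_field_derivative_def mult_commute_abs)
    then show "((\<lambda>t. snd (w t)) has_real_derivative - a * snd (w t) - c t * fst (w t)) (at t within {0..})"
      using t by (auto simp: M_def C_def intro: has_field_derivative_at_within)
  qed (use w(1) in auto)
  then show ?thesis by (rule that)
qed

text \<open>The difference \<open>z = u - v\<close> solves the equation of \<open>d\<close> with
  forcing \<open>- (c - d) * u\<close>, so bounds on \<open>d\<close> and \<open>u\<close> suffice
  for a Gronwall estimate of \<open>z\<^sup>2 + z'\<^sup>2\<close>.\<close>

lemma sine_like_solution_dependence:
  assumes u: "sine_like_solution a c u u'" and v: "sine_like_solution a d v v'"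
    and B: "\<And>t. 0 \<le> t \<Longrightarrow> \<bar>d t\<bar> \<le> B"
    and cd: "\<And>t. 0 \<le> t \<Longrightarrow> \<bar>c t - d t\<bar> \<le> \<eta>"
    and M: "\<And>t. 0 \<le> t \<Longrightarrow> t \<le> T \<Longrightarrow> \<bar>u t\<bar> \<le> M"
    and t: "0 \<le> t" "t \<le> T"
  shows "(u t - v t)\<^sup>2 + (u' t - v' t)\<^sup>2 \<le> (\<eta> * M)\<^sup>2 * T * exp ((2 + B + 2 * \<bar>a\<bar>) * T)"
proof -
  \<comment> \<open>The rate collects 1 from \<open>2 * z * z'\<close>,
    \<open>2 * \<bar>a\<bar>\<close> from the damping, \<open>B\<close> from the term with
    \<open>d\<close>, and 1 from the forcing.\<close>
  define L where "L = 2 + B + 2 * \<bar>a\<bar>"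
  have L: "0 \<le> L" using B[of 0] by (simp add: L_def)
  define z where "z t = u t - v t" for t
  define z' where "z' t = u' t - v' t" for t
  define e where "e t = (z t)\<^sup>2 + (z' t)\<^sup>2" for t
  \<comment> \<open>The integrating factor and the subtracted forcing make \<open>f\<close>
    nonincreasing, and \<open>f 0 = 0\<close>.\<close>
  define f where "f t = exp (- L * t) * e t - (\<eta> * M)\<^sup>2 * t" for t
  have z0: "z 0 = 0" "z' 0 = 0" using u v by (auto simp: sine_like_solution_def z_def z'_def)
  define r where "r t = - a * z' t - d t * z t - (c t - d t) * u t" for t
  have f': "\<exists>y. (f has_real_derivative y) (at s within {0..t}) \<and> y \<le> 0" if s: "0 \<le> s" "s \<le> t" for s
  proof -
    have us: "(u has_real_derivative u' s) (at s within {0..t})"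
      "(u' has_real_derivative - a * u' s - c s * u s) (at s within {0..t})"
      using u s unfolding sine_like_solution_def
      by (auto intro: has_field_derivative_subset)
    have vs: "(v has_real_derivative v' s) (at s within {0..t})"
      "(v' has_real_derivative - a * v' s - d s * v s) (at s within {0..t})"
      using v s unfolding sine_like_solution_def
      by (auto intro: has_field_derivative_subset)
    have zs: "(z has_real_derivative z' s) (at s within {0..t})"
      unfolding z_def z'_def by (intro derivative_intros us vs)
    have "(z' has_real_derivative (- a * u' s - c s * u s) - (- a * v' s - d s * v s)) (at s within {0..t})"
      unfolding z'_def by (intro derivative_intros us vs)
    then have z's: "(z' has_real_derivative r s) (at s within {0..t})"
      by (simp add: r_def z_def z'_def algebra_simps)
    have "(f has_real_derivative exp (- L * s) * (2 * z s * z' s + 2 * z' s * r s)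
            - L * exp (- L * s) * e s - (\<eta> * M)\<^sup>2) (at s within {0..t})"
      unfolding f_def e_def
      by (auto intro!: derivative_eq_intros zs z's simp: algebra_simps)
    moreover have "exp (- L * s) * (2 * z s * z' s + 2 * z' s * r s)
            - L * exp (- L * s) * e s - (\<eta> * M)\<^sup>2 \<le> 0"
    proof -
      have p: "2 * x * y \<le> x\<^sup>2 + y\<^sup>2" for x y :: real
        using sum_squares_bound[of x y] by simp
      have 1: "2 * z s * z' s \<le> e s" unfolding e_def using p[of "z s" "z' s"] by simp
      have 2: "2 * z' s * (- a * z' s) \<le> 2 * \<bar>a\<bar> * e s"
      proof -
        have "- a * (z' s)\<^sup>2 \<le> \<bar>a\<bar> * e s" unfolding e_def by (intro mult_mono) auto
        then show ?thesis by (simp add: power2_eq_square algebra_simps)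
      qed
      have 3: "2 * z' s * (- d s * z s) \<le> B * e s"
      proof -
        have "2 * z' s * (- d s * z s) \<le> \<bar>2 * z' s * (- d s * z s)\<bar>" by simp
        also have "\<dots> = \<bar>d s\<bar> * (2 * \<bar>z s\<bar> * \<bar>z' s\<bar>)" by (simp add: abs_mult)
        also have "\<dots> \<le> B * e s" unfolding e_def using p[of "\<bar>z s\<bar>" "\<bar>z' s\<bar>"] B[OF s(1)]
          by (intro mult_mono) auto
        finally show ?thesis .
      qed
      have 4: "2 * z' s * (- (c s - d s) * u s) \<le> e s + (\<eta> * M)\<^sup>2"
      proof -
        have "\<bar>(c s - d s) * u s\<bar> \<le> \<eta> * M" unfolding abs_mult
          using cd[OF s(1)] M[of s] s t by (intro mult_mono) auto
        then have "((c s - d s) * u s)\<^sup>2 \<le> (\<eta> * M)\<^sup>2" 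
          by (rule abs_le_square_iff[THEN iffD1, OF order_trans[OF _ abs_ge_self]])
        moreover have "2 * z' s * (- (c s - d s) * u s) \<le> (z' s)\<^sup>2 + ((c s - d s) * u s)\<^sup>2"
          using p[of "z' s" "- (c s - d s) * u s"] by (simp add: power_mult_distrib power2_commute)
        ultimately show ?thesis unfolding e_def by (smt (verit) zero_le_power2)
      qed
      have "2 * z s * z' s + 2 * z' s * r s = 2 * z s * z' s + 2 * z' s * (- a * z' s)
          + 2 * z' s * (- d s * z s) + 2 * z' s * (- (c s - d s) * u s)"
        by (simp add: r_def algebra_simps)
      also have "\<dots> \<le> L * e s + (\<eta> * M)\<^sup>2" using 1 2 3 4 unfolding L_def by (simp add: algebra_simps)
      finally have "exp (- L * s) * (2 * z s * z' s + 2 * z' s * r s) \<le> exp (- L * s) * (L * e s + (\<eta> * M)\<^sup>2)"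
        by (intro mult_left_mono) auto
      moreover have "exp (- L * s) * (\<eta> * M)\<^sup>2 \<le> (\<eta> * M)\<^sup>2"
        using L s by (simp add: mult_left_le_one_le)
      ultimately show ?thesis by (simp add: algebra_simps)
    qed
    ultimately show ?thesis by blast
  qed
  have "f t \<le> f 0"
  proof (rule DERIV_nonpos_imp_decreasing_open[OF t(1)])
    show "\<exists>y. (f has_real_derivative y) (at s) \<and> y \<le> 0" if "0 < s" "s < t" for s
      using f'[of s] that by (simp add: at_within_Icc_at)
    show "continuous_on {0..t} f"
      unfolding continuous_on_eq_continuous_within using f' DERIV_continuous by fastforce
  qed
  then have "exp (- L * t) * e t \<le> (\<eta> * M)\<^sup>2 * t" by (simp add: f_def e_def z0)
  then have "e t \<le> (\<eta> * M)\<^sup>2 * t * exp (L * t)" by (simp add: exp_minus field_simps)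
  also have "\<dots> \<le> (\<eta> * M)\<^sup>2 * T * exp (L * T)"
    using t L by (intro mult_mono mult_nonneg_nonneg) (auto intro: mult_left_mono)
  finally show ?thesis by (simp add: e_def z_def z'_def L_def)
qed

section \<open>Smoothing Hoelder functions\<close>

lemma holder_continuous_on:
  fixes f :: "real \<Rightarrow> real"
  assumes "\<And>t s. t \<in> X \<Longrightarrow> s \<in> X \<Longrightarrow> \<bar>f t - f s\<bar> \<le> C * \<bar>t - s\<bar> powr \<alpha>" and "0 < \<alpha>"
  shows "continuous_on X f"
proof -
  have lim: "((\<lambda>t. C * \<bar>t - s\<bar> powr \<alpha>) \<longlongrightarrow> 0) (at s within X)" for s :: real
  proof -
    have "((\<lambda>t. C * \<bar>t - s\<bar> powr \<alpha>) \<longlongrightarrow> C * \<bar>s - s\<bar> powr \<alpha>) (at s within X)"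
      using assms(2) by (intro tendsto_intros) auto
    then show ?thesis by simp
  qed
  have le: "\<forall>\<^sub>F t in at s within X. norm (f t - f s) \<le> C * \<bar>t - s\<bar> powr \<alpha>" if "s \<in> X" for s
    unfolding eventually_at_filter by (rule always_eventually) (use assms(1) that in simp)
  have "((\<lambda>t. f t - f s) \<longlongrightarrow> 0) (at s within X)" if "s \<in> X" for s
    by (rule Lim_null_comparison[OF le[OF that] lim])
  then have "(f \<longlongrightarrow> f s) (at s within X)" if "s \<in> X" for s
    using LIM_zero_cancel that by blast
  then show ?thesis unfolding continuous_on_def by blast
qed

text \<open>The average is written through a primitive: the mean value theorem then
  turns every bound on \<open>c\<close> into the same bound on its average.\<close>

lemma forward_average:
  fixes c :: "real \<Rightarrow> real"
  assumes cont: "continuous_on UNIV c" and h: "0 < h"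
    and m: "\<And>t. m1 \<le> c t" "\<And>t. c t \<le> m2"
    and hol: "\<And>t s. \<bar>c t - c s\<bar> \<le> K * \<bar>t - s\<bar> powr \<alpha>" and "0 < \<alpha>" "0 \<le> K"
  obtains g where "\<And>t. (g has_real_derivative (c (t + h) - c t) / h) (at t)"
    "\<And>t. m1 \<le> g t" "\<And>t. g t \<le> m2"
    "\<And>t s. \<bar>g t - g s\<bar> \<le> K * \<bar>t - s\<bar> powr \<alpha>"
    "\<And>t. \<bar>g t - c t\<bar> \<le> K * h powr \<alpha>"
proof -
  obtain F where F: "\<And>t. (F has_real_derivative c t) (at t)"
    using antiderivative_real[OF cont] by metis
  define g where "g t = (F (t + h) - F t) / h" for t
  have Fs: "((\<lambda>t. F (t + x)) has_real_derivative c (t + x)) (at t)" for t x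
    using F[of "t + x"] by (simp add: DERIV_shift)
  have mean: "\<exists>x. t < x \<and> x < t + h \<and> g t = c x" for t
  proof -
    obtain x where "t < x" "x < t + h" "F (t + h) - F t = (t + h - t) * c x"
      using MVT2[of t "t + h" F c] F h by auto
    then show ?thesis using h by (intro exI[of _ x]) (auto simp: g_def)
  qed
  show ?thesis
  proof (rule that[of g])
    show "(g has_real_derivative (c (t + h) - c t) / h) (at t)" for t
      unfolding g_def using h by (auto intro!: derivative_eq_intros Fs F)
    show "m1 \<le> g t" "g t \<le> m2" for t using mean[of t] m by auto
    show "\<bar>g t - c t\<bar> \<le> K * h powr \<alpha>" for t
    proof -
      obtain x where x: "t < x" "x < t + h" "g t = c x" using mean by blast
      have "\<bar>g t - c t\<bar> \<le> K * \<bar>x - t\<bar> powr \<alpha>" using hol[of x t] x by simp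
      also have "\<dots> \<le> K * h powr \<alpha>"
        using x assms by (intro mult_left_mono powr_mono2) auto
      finally show ?thesis .
    qed
    show "\<bar>g t - g s\<bar> \<le> K * \<bar>t - s\<bar> powr \<alpha>" for t s
    proof -
      \<comment> \<open>The mean value theorem is applied to both averages jointly: the same offset
        \<open>x\<close> occurs at \<open>t\<close> and at \<open>s\<close>, so the increment stays
        \<open>t - s\<close>.\<close>
      have "((\<lambda>x. F (x + t) - F (x + s)) has_real_derivative c (x + t) - c (x + s)) (at x)" for x
        using DERIV_diff[OF F[of "x + t", THEN DERIV_shift[THEN iffD1]] F[of "x + s", THEN DERIV_shift[THEN iffD1]]] .
      then obtain x where "0 < x" "x < h"
        "(F (h + t) - F (h + s)) - (F (0 + t) - F (0 + s)) = (h - 0) * (c (x + t) - c (x + s))"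
        using MVT2[of 0 h "\<lambda>x. F (x + t) - F (x + s)" "\<lambda>x. c (x + t) - c (x + s)"] h by blast
      then have "(F (t + h) - F t) - (F (s + h) - F s) = h * (c (x + t) - c (x + s))"
        by (simp add: add.commute[of h])
      then have "g t - g s = c (x + t) - c (x + s)"
        using h by (simp add: g_def diff_divide_distrib[symmetric])
      then show ?thesis using hol[of "x + t" "x + s"] by simp
    qed
  qed
qed

lemma bounded_difference_quotient:
  fixes f :: "real \<Rightarrow> real"
  assumes "\<And>t. \<bar>f t\<bar> \<le> B" "0 < h"
  shows "\<bar>(f (t + h) - f t) / h\<bar> \<le> 2 * B / h"
  using assms(1)[of "t + h"] assms(1)[of t] assms(2) by (auto simp: field_simps abs_le_iff)

text \<open>Three successive forward averages give three bounded derivatives while keeping the range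
  and the Hoelder constant. The third derivative is needed because differentiating the resonator
  brings in \<open>q2\<close>.\<close>

lemma smooth_holder_approximation:
  fixes c :: "real \<Rightarrow> real"
  assumes m: "\<And>t. m1 \<le> c t" "\<And>t. c t \<le> m2"
    and hol: "\<And>t s. \<bar>c t - c s\<bar> \<le> K * \<bar>t - s\<bar> powr \<alpha>" and \<alpha>: "0 < \<alpha>" and K: "0 \<le> K"
    and e: "0 < e"
  obtains g g1 g2 g3 B where
    "\<And>t. (g has_real_derivative g1 t) (at t)"
    "\<And>t. (g1 has_real_derivative g2 t) (at t)"
    "\<And>t. (g2 has_real_derivative g3 t) (at t)"
    "\<And>t. \<bar>g1 t\<bar> \<le> B" "\<And>t. \<bar>g2 t\<bar> \<le> B" "\<And>t. \<bar>g3 t\<bar> \<le> B"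
    "\<And>t. m1 \<le> g t" "\<And>t. g t \<le> m2"
    "\<And>t s. \<bar>g t - g s\<bar> \<le> K * \<bar>t - s\<bar> powr \<alpha>"
    "\<And>t. \<bar>g t - c t\<bar> \<le> e"
proof -
  \<comment> \<open>Each of the three averages costs at most \<open>K * h powr \<alpha>\<close>;
    \<open>K + 1\<close> keeps the quotient meaningful when \<open>K = 0\<close>.\<close>
  define h where "h = (e / (3 * (K + 1))) powr (1 / \<alpha>)"
  have h: "0 < h" using e K by (simp add: h_def)
  have "h powr \<alpha> = e / (3 * (K + 1))" using e K \<alpha> by (simp add: h_def powr_powr)
  then have "3 * (K * h powr \<alpha>) = e * (K / (K + 1))" using K by (simp add: field_simps)
  also have "\<dots> \<le> e" using e K by (intro mult_right_le_one_le) auto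
  finally have Kh: "3 * (K * h powr \<alpha>) \<le> e" .
  obtain a where a: "\<And>t. (a has_real_derivative (c (t + h) - c t) / h) (at t)"
    "\<And>t. m1 \<le> a t" "\<And>t. a t \<le> m2" "\<And>t s. \<bar>a t - a s\<bar> \<le> K * \<bar>t - s\<bar> powr \<alpha>"
    "\<And>t. \<bar>a t - c t\<bar> \<le> K * h powr \<alpha>"
    by (rule forward_average[OF holder_continuous_on[OF hol \<alpha>] h m hol \<alpha> K], rule that)
  obtain b where b: "\<And>t. (b has_real_derivative (a (t + h) - a t) / h) (at t)"
    "\<And>t. m1 \<le> b t" "\<And>t. b t \<le> m2" "\<And>t s. \<bar>b t - b s\<bar> \<le> K * \<bar>t - s\<bar> powr \<alpha>"
    "\<And>t. \<bar>b t - a t\<bar> \<le> K * h powr \<alpha>"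
    by (rule forward_average[OF holder_continuous_on[OF a(4) \<alpha>] h a(2-4) \<alpha> K], rule that)
  obtain g where g: "\<And>t. (g has_real_derivative (b (t + h) - b t) / h) (at t)"
    "\<And>t. m1 \<le> g t" "\<And>t. g t \<le> m2" "\<And>t s. \<bar>g t - g s\<bar> \<le> K * \<bar>t - s\<bar> powr \<alpha>"
    "\<And>t. \<bar>g t - b t\<bar> \<le> K * h powr \<alpha>"
    by (rule forward_average[OF holder_continuous_on[OF b(4) \<alpha>] h b(2-4) \<alpha> K], rule that)
  \<comment> \<open>Differentiating an average gives a difference quotient, so each derivative of
    \<open>g\<close> comes from the next lower one of \<open>b\<close>, down to \<open>a1\<close>,
    which involves only the values of \<open>c\<close>.\<close>
  define a1 where "a1 t = (c (t + h) - c t) / h" for t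
  define b1 where "b1 t = (a (t + h) - a t) / h" for t
  define b2 where "b2 t = (a1 (t + h) - a1 t) / h" for t
  define g1 where "g1 t = (b (t + h) - b t) / h" for t
  define g2 where "g2 t = (b1 (t + h) - b1 t) / h" for t
  define g3 where "g3 t = (b2 (t + h) - b2 t) / h" for t
  have quot: "((\<lambda>t. (f (t + h) - f t) / h) has_real_derivative (f' (t + h) - f' t) / h) (at t)"
    if "\<And>t. (f has_real_derivative f' t) (at t)" for f f' :: "real \<Rightarrow> real" and t
  proof -
    have "((\<lambda>t. f (t + h)) has_real_derivative f' (t + h)) (at t)"
      using that[of "t + h"] by (simp add: DERIV_shift)
    then show ?thesis using h by (auto intro!: derivative_eq_intros that)
  qed
  define M where "M = \<bar>m1\<bar> + \<bar>m2\<bar>"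
  have cM: "\<bar>c t\<bar> \<le> M" and aM: "\<bar>a t\<bar> \<le> M" and bM: "\<bar>b t\<bar> \<le> M" for t
    using m[of t] a(2,3)[of t] b(2,3)[of t] by (auto simp: M_def)
  note dq = bounded_difference_quotient[OF _ h]
  have a1: "\<bar>a1 t\<bar> \<le> 2 * M / h" and b1: "\<bar>b1 t\<bar> \<le> 2 * M / h" and g1: "\<bar>g1 t\<bar> \<le> 2 * M / h" for t
    unfolding a1_def b1_def g1_def by (intro dq cM aM bM)+
  have b2: "\<bar>b2 t\<bar> \<le> 2 * (2 * M / h) / h" and g2: "\<bar>g2 t\<bar> \<le> 2 * (2 * M / h) / h" for t
    unfolding b2_def g2_def by (intro dq a1 b1)+
  have g3: "\<bar>g3 t\<bar> \<le> 2 * (2 * (2 * M / h) / h) / h" for t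
    unfolding g3_def by (intro dq b2)
  define B where "B = max (2 * M / h) (max (2 * (2 * M / h) / h) (2 * (2 * (2 * M / h) / h) / h))"
  have b1': "(b1 has_real_derivative b2 t) (at t)" for t
    unfolding b1_def b2_def by (rule quot) (simp add: a1_def a)
  show ?thesis
  proof (rule that[of g g1 g2 g3 B])
    show "(g has_real_derivative g1 t) (at t)" for t using g(1) by (simp add: g1_def)
    show "(g1 has_real_derivative g2 t) (at t)" for t
      unfolding g1_def g2_def by (rule quot) (simp add: b1_def b)
    show "(g2 has_real_derivative g3 t) (at t)" for t
      unfolding g2_def g3_def by (rule quot) (rule b1')
    show "\<bar>g1 t\<bar> \<le> B" "\<bar>g2 t\<bar> \<le> B" "\<bar>g3 t\<bar> \<le> B" for t
      using g1[of t] g2[of t] g3[of t] by (auto simp: B_def)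
    show "\<bar>g t - c t\<bar> \<le> e" for t using a(5)[of t] b(5)[of t] g(5)[of t] Kh by linarith
  qed (use g in auto)
qed

lemma le_interpolation:
  fixes x a b \<alpha> :: real
  assumes "0 \<le> x" "x \<le> a" "x \<le> b" "0 \<le> \<alpha>" "\<alpha> \<le> 1"
  shows "x \<le> a powr (1 - \<alpha>) * b powr \<alpha>"
proof (cases "x = 0")
  case False
  then have "x = x powr (1 - \<alpha>) * x powr \<alpha>" using assms by (simp add: powr_add[symmetric])
  also have "\<dots> \<le> a powr (1 - \<alpha>) * b powr \<alpha>" using assms by (intro mult_mono powr_mono2) auto
  finally show ?thesis .
qed simp

lemma lipschitz_of_bounded_derivative:
  fixes f :: "real \<Rightarrow> real"
  assumes "\<And>t. (f has_real_derivative f' t) (at t)" "\<And>t. \<bar>f' t\<bar> \<le> B"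
  shows "\<bar>f t - f s\<bar> \<le> B * \<bar>t - s\<bar>"
  using field_differentiable_bound[of UNIV f f' B t s] assms by auto

text \<open>Interpolation between the oscillation bound \<open>2 * A\<close> and the Lipschitz
  bound. It is meant for \<open>A\<close> of order \<open>l powr (- \<alpha>)\<close> and
  \<open>B\<close> of order \<open>l powr (1 - \<alpha>)\<close>, where the powers of
  \<open>l\<close> cancel.\<close>

lemma holder_of_bounded_derivative:
  fixes f :: "real \<Rightarrow> real"
  assumes "\<And>t. (f has_real_derivative f' t) (at t)" "\<And>t. \<bar>f t\<bar> \<le> A" "\<And>t. \<bar>f' t\<bar> \<le> B"
    and "0 \<le> \<alpha>" "\<alpha> \<le> 1"
  shows "\<bar>f t - f s\<bar> \<le> (2 * A) powr (1 - \<alpha>) * B powr \<alpha> * \<bar>t - s\<bar> powr \<alpha>"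
proof -
  have "\<bar>f t - f s\<bar> \<le> 2 * A" using assms(2)[of t] assms(2)[of s] by linarith
  moreover have "\<bar>f t - f s\<bar> \<le> B * \<bar>t - s\<bar>"
    by (rule lipschitz_of_bounded_derivative[OF assms(1,3)])
  ultimately have "\<bar>f t - f s\<bar> \<le> (2 * A) powr (1 - \<alpha>) * (B * \<bar>t - s\<bar>) powr \<alpha>"
    using assms by (intro le_interpolation) auto
  moreover have "0 \<le> B" using assms(3)[of 0] by linarith
  ultimately show ?thesis by (simp add: powr_mult algebra_simps)
qed

section \<open>Resonant perturbation of a smooth speed\<close>

lemma abs_mult_le:
  fixes x y a b :: real
  assumes "\<bar>x\<bar> \<le> a" "\<bar>y\<bar> \<le> b"
  shows "\<bar>x * y\<bar> \<le> a * b"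
  using assms by (auto simp: abs_mult intro!: mult_mono')

text \<open>Here \<open>w\<close> is the square root of the speed and \<open>q = w' / (2 w)\<close>.\<close>

locale smooth_speed =
  fixes w q q1 q2 \<Phi> :: "real \<Rightarrow> real" and m1 m2 Q :: real
  assumes w': "\<And>t. (w has_real_derivative 2 * q t * w t) (at t)"
    and q': "\<And>t. (q has_real_derivative q1 t) (at t)"
    and q1': "\<And>t. (q1 has_real_derivative q2 t) (at t)"
    and \<Phi>': "\<And>t. (\<Phi> has_real_derivative w t) (at t)"
    and \<Phi>_0: "\<Phi> 0 = 0"
    and m1_pos: "0 < m1" and w_ge: "\<And>t. m1 \<le> w t" and w_le: "\<And>t. w t \<le> m2"
    and q_le: "\<And>t. \<bar>q t\<bar> \<le> Q" and q1_le: "\<And>t. \<bar>q1 t\<bar> \<le> Q" and q2_le: "\<And>t. \<bar>q2 t\<bar> \<le> Q"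
begin

lemma w_pos: "0 < w t"
  using m1_pos w_ge[of t] by simp

lemma m2_pos: "0 < m2"
  using w_pos[of 0] w_le[of 0] by simp

lemma Q_nonneg: "0 \<le> Q"
  using q_le[of 0] by simp

text \<open>Solving \<open>u'' + 2 D u' + c l\<^sup>2 u = 0\<close> for \<open>c\<close> with \<open>u = sin (l \<Phi>) e\<^sup>b\<close> and
  \<open>b' = - D - q + \<kappa> sin\<^sup>2 (l \<Phi>)\<close> gives \<open>c = w\<^sup>2 + resonator l \<kappa> D\<close>; this choice of \<open>b'\<close> makes
  \<open>u'' + 2 D u'\<close> divisible by \<open>sin (l \<Phi>)\<close>.\<close>

definition resonator :: "real \<Rightarrow> real \<Rightarrow> real \<Rightarrow> real \<Rightarrow> real" where
  "resonator l \<kappa> D t = - 2 * (\<kappa> / l) * w t * sin (2 * (l * \<Phi> t))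
     + (q1 t - (\<kappa> * (sin (l * \<Phi> t))\<^sup>2 - q t)\<^sup>2 + D\<^sup>2) / l\<^sup>2"

definition resonator_deriv :: "real \<Rightarrow> real \<Rightarrow> real \<Rightarrow> real" where
  "resonator_deriv l \<kappa> t =
     - 2 * (\<kappa> / l) * (2 * q t * w t * sin (2 * (l * \<Phi> t)) + w t * (2 * (l * w t) * cos (2 * (l * \<Phi> t))))
     + (q2 t - 2 * (\<kappa> * (sin (l * \<Phi> t))\<^sup>2 - q t) * (\<kappa> * (l * w t) * sin (2 * (l * \<Phi> t)) - q1 t)) / l\<^sup>2"

lemma resonator_has_derivative:
  "(resonator l \<kappa> D has_real_derivative resonator_deriv l \<kappa> t) (at t)"
proof -
  have sin2': "((\<lambda>t. sin (2 * (l * \<Phi> t))) has_real_derivative cos (2 * (l * \<Phi> t)) * (2 * (l * w t))) (at t)"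
    by (auto intro!: derivative_eq_intros \<Phi>')
  have 1: "((\<lambda>t. - 2 * (\<kappa> / l) * (w t * sin (2 * (l * \<Phi> t)))) has_real_derivative
      - 2 * (\<kappa> / l) * (2 * q t * w t * sin (2 * (l * \<Phi> t)) + cos (2 * (l * \<Phi> t)) * (2 * (l * w t)) * w t)) (at t)"
    by (intro DERIV_cmult DERIV_mult w' sin2')
  have 2: "((\<lambda>t. q1 t - (\<kappa> * (sin (l * \<Phi> t))\<^sup>2 - q t)\<^sup>2 + D\<^sup>2) has_real_derivative
      q2 t - 2 * (\<kappa> * (sin (l * \<Phi> t))\<^sup>2 - q t) * (\<kappa> * (2 * sin (l * \<Phi> t) * (cos (l * \<Phi> t) * (l * w t))) - q1 t)) (at t)"
    by (auto intro!: derivative_eq_intros q' q1' \<Phi>' simp: algebra_simps)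
  have eq: "resonator l \<kappa> D = (\<lambda>t. - 2 * (\<kappa> / l) * (w t * sin (2 * (l * \<Phi> t)))
     + (q1 t - (\<kappa> * (sin (l * \<Phi> t))\<^sup>2 - q t)\<^sup>2 + D\<^sup>2) / l\<^sup>2)"
    by (simp add: resonator_def fun_eq_iff mult.assoc)
  show ?thesis unfolding eq
    by (rule DERIV_cong[OF DERIV_add[OF 1 DERIV_cdivide[OF 2]]])
       (unfold resonator_deriv_def sin_double, simp only: mult_ac)
qed

lemma square_minus_bound:
  assumes "0 \<le> \<kappa>"
  shows "\<bar>\<kappa> * (sin x)\<^sup>2 - q t\<bar> \<le> \<kappa> + Q"
proof -
  have "\<kappa> * (sin x)\<^sup>2 \<le> \<kappa>" "0 \<le> \<kappa> * (sin x)\<^sup>2"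
    using assms by (auto intro!: mult_right_le_one_le simp: abs_square_le_1)
  then show ?thesis using q_le[of t] by linarith
qed

lemma resonator_bound:
  assumes "0 < l" "0 \<le> \<kappa>"
  shows "\<bar>resonator l \<kappa> D t\<bar> \<le> 2 * (\<kappa> / l) * m2 + (Q + (\<kappa> + Q)\<^sup>2 + D\<^sup>2) / l\<^sup>2"
proof -
  have "\<bar>w t * sin (2 * (l * \<Phi> t))\<bar> \<le> m2 * 1"
    unfolding abs_mult using w_le[of t] w_pos[of t] by (intro mult_mono) auto
  then have "2 * (\<kappa> / l) * \<bar>w t * sin (2 * (l * \<Phi> t))\<bar> \<le> 2 * (\<kappa> / l) * m2"
    using assms by (intro mult_left_mono) auto
  then have 1: "\<bar>- 2 * (\<kappa> / l) * w t * sin (2 * (l * \<Phi> t))\<bar> \<le> 2 * (\<kappa> / l) * m2"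
    using assms by (simp add: abs_mult mult.assoc)
  have "(\<kappa> * (sin (l * \<Phi> t))\<^sup>2 - q t)\<^sup>2 \<le> (\<kappa> + Q)\<^sup>2"
    using square_minus_bound[OF assms(2)] assms(2) Q_nonneg by (intro power2_le_iff_abs_le[THEN iffD2]) auto
  then have "\<bar>q1 t - (\<kappa> * (sin (l * \<Phi> t))\<^sup>2 - q t)\<^sup>2 + D\<^sup>2\<bar> \<le> Q + (\<kappa> + Q)\<^sup>2 + D\<^sup>2"
    using q1_le[of t] by (smt (verit) zero_le_power2)
  then have "\<bar>(q1 t - (\<kappa> * (sin (l * \<Phi> t))\<^sup>2 - q t)\<^sup>2 + D\<^sup>2) / l\<^sup>2\<bar> \<le> (Q + (\<kappa> + Q)\<^sup>2 + D\<^sup>2) / l\<^sup>2"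
    using assms by (simp add: divide_right_mono)
  with 1 show ?thesis unfolding resonator_def by linarith
qed

lemma resonator_deriv_bound:
  assumes "0 < l" "0 \<le> \<kappa>"
  shows "\<bar>resonator_deriv l \<kappa> t\<bar> \<le> 2 * (\<kappa> / l) * (2 * Q * m2 + 2 * l * m2\<^sup>2)
      + (Q + 2 * (\<kappa> + Q) * (\<kappa> * l * m2 + Q)) / l\<^sup>2"
proof -
  let ?s = "sin (2 * (l * \<Phi> t))" and ?c = "cos (2 * (l * \<Phi> t))"
  note w = less_imp_le[OF w_pos[of t]] w_le[of t]
  have wm: "\<bar>w t\<bar> \<le> m2" using w by simp
  have "\<bar>2 * q t * w t * ?s\<bar> \<le> 2 * Q * m2 * 1"
    by (intro abs_mult_le wm q_le) auto
  moreover have "\<bar>w t * (2 * (l * w t) * ?c)\<bar> \<le> m2 * (2 * (l * m2) * 1)"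
    by (intro abs_mult_le wm) (use assms in auto)
  moreover have "m2 * (2 * (l * m2) * 1) = 2 * l * m2\<^sup>2" by (simp add: power2_eq_square)
  ultimately have "\<bar>2 * q t * w t * ?s + w t * (2 * (l * w t) * ?c)\<bar> \<le> 2 * Q * m2 + 2 * l * m2\<^sup>2"
    by linarith
  then have "2 * (\<kappa> / l) * \<bar>2 * q t * w t * ?s + w t * (2 * (l * w t) * ?c)\<bar>
      \<le> 2 * (\<kappa> / l) * (2 * Q * m2 + 2 * l * m2\<^sup>2)"
    using assms by (intro mult_left_mono) auto
  then have 1: "\<bar>- 2 * (\<kappa> / l) * (2 * q t * w t * ?s + w t * (2 * (l * w t) * ?c))\<bar>
      \<le> 2 * (\<kappa> / l) * (2 * Q * m2 + 2 * l * m2\<^sup>2)"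
    using assms by (simp add: abs_mult)
  have "\<bar>\<kappa> * (l * w t) * ?s\<bar> \<le> \<kappa> * (l * m2) * 1"
    by (intro abs_mult_le wm) (use assms in auto)
  then have "\<bar>\<kappa> * (l * w t) * ?s - q1 t\<bar> \<le> \<kappa> * l * m2 + Q"
    using q1_le[of t] by (simp add: mult.assoc)
  then have "\<bar>2 * (\<kappa> * (sin (l * \<Phi> t))\<^sup>2 - q t) * (\<kappa> * (l * w t) * ?s - q1 t)\<bar>
      \<le> 2 * (\<kappa> + Q) * (\<kappa> * l * m2 + Q)"
    by (intro abs_mult_le square_minus_bound[OF assms(2)]) auto
  then have "\<bar>q2 t - 2 * (\<kappa> * (sin (l * \<Phi> t))\<^sup>2 - q t) * (\<kappa> * (l * w t) * ?s - q1 t)\<bar>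
      \<le> Q + 2 * (\<kappa> + Q) * (\<kappa> * l * m2 + Q)"
    using q2_le[of t] by linarith
  then have "\<bar>(q2 t - 2 * (\<kappa> * (sin (l * \<Phi> t))\<^sup>2 - q t) * (\<kappa> * (l * w t) * ?s - q1 t)) / l\<^sup>2\<bar>
      \<le> (Q + 2 * (\<kappa> + Q) * (\<kappa> * l * m2 + Q)) / l\<^sup>2"
    using assms by (simp add: divide_right_mono)
  with 1 show ?thesis unfolding resonator_deriv_def by linarith
qed

text \<open>The mean of the squared sine is 1/2. The remaining cosine of
  \<open>2 * (l * \<Phi> t)\<close> oscillates, and integrating it by parts gains a factor of order
  \<open>1 / l\<close>.\<close>

lemma integral_sin_squared_lower:
  assumes M': "\<And>t. (M has_real_derivative (sin (l * \<Phi> t))\<^sup>2) (at t)" and "M 0 = 0" "0 < l" "0 \<le> t"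
  shows "M t \<ge> t / 2 - (1 / 4 + Q * t / 2) / (l * m1)"
proof -
  \<comment> \<open>The last term is the boundary term of that integration by parts; only
    \<open>f1\<close>, bounded by \<open>Q / (2 * l * m1)\<close>, survives differentiation.\<close>
  define f where "f t = M t - t / 2 + sin (2 * (l * \<Phi> t)) / (4 * l * w t)" for t
  define f1 where "f1 t = - q t * sin (2 * (l * \<Phi> t)) / (2 * l * w t)" for t
  have f': "(f has_real_derivative f1 t) (at t)" for t
  proof -
    have w0: "w t \<noteq> 0" "l \<noteq> 0" using w_pos[of t] assms by auto
    have "(f has_real_derivative (sin (l * \<Phi> t))\<^sup>2 - 1 / 2
       + (cos (2 * (l * \<Phi> t)) * (2 * (l * w t)) * (4 * l * w t) - sin (2 * (l * \<Phi> t)) * (4 * l * (2 * q t * w t)))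
         / ((4 * l * w t) * (4 * l * w t))) (at t)"
      unfolding f_def by (rule derivative_eq_intros M' \<Phi>' w' refl | use w0 in simp)+
    moreover have "(x * (2 * (l * w t)) * (4 * l * w t) - y * (4 * l * (2 * q t * w t)))
         / ((4 * l * w t) * (4 * l * w t)) = x / 2 - q t * y / (2 * l * w t)" for x y
      using w0 by (simp add: field_simps)
    ultimately have "(f has_real_derivative (sin (l * \<Phi> t))\<^sup>2 - 1 / 2
       + (cos (2 * (l * \<Phi> t)) / 2 - q t * sin (2 * (l * \<Phi> t)) / (2 * l * w t))) (at t)" by simp
    then show ?thesis
      by (rule DERIV_cong) (simp add: f1_def cos_double_sin diff_divide_distrib)
  qed
  have "\<bar>f1 t\<bar> \<le> Q * 1 / (2 * l * m1)" for t
    unfolding f1_def abs_divide abs_mult[of _ "sin _"]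
    using q_le[of t] Q_nonneg w_ge[of t] m1_pos assms
    by (intro frac_le mult_mono mult_pos_pos) (auto simp: abs_mult)
  then have "\<bar>f t - f 0\<bar> \<le> Q * 1 / (2 * l * m1) * \<bar>t - 0\<bar>"
    by (rule lipschitz_of_bounded_derivative[OF f'])
  then have 1: "f t \<ge> - (Q * t / 2 / (l * m1))"
    using assms by (simp add: f_def \<Phi>_0)
  have "\<bar>sin (2 * (l * \<Phi> t)) / (4 * l * w t)\<bar> \<le> 1 / (4 * l * m1)"
    unfolding abs_divide using w_ge[of t] m1_pos assms by (intro frac_le) (auto simp: abs_mult)
  from abs_le_D1[OF this] have 2: "sin (2 * (l * \<Phi> t)) / (4 * l * w t) \<le> 1 / 4 / (l * m1)" by simp
  show ?thesis using 1 2 unfolding f_def by (simp only: add_divide_distrib)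
qed

text \<open>The explicit solution \<open>sin (l \<Phi>) e^b\<close> is normalised to slope 1 at 0.
  The average of the squared sine turns \<open>\<kappa>\<close> into the growth rate
  \<open>\<kappa> / 2\<close>, against the damping rate \<open>D\<close>. The hypothesis
  \<open>small\<close> keeps the amplitude derivative \<open>b1\<close> below \<open>l / 2\<close>,
  so \<open>u\<close> and \<open>u'\<close> cannot be small together.\<close>

lemma resonance_growth:
  assumes l: "1 \<le> l" and \<kappa>: "0 \<le> \<kappa>" and D: "0 \<le> D" and small: "D + \<kappa> + Q \<le> l / 2"
  obtains u u' where
    "sine_like_solution (2 * D) (\<lambda>t. ((w t)\<^sup>2 + resonator l \<kappa> D t) * l\<^sup>2) u u'"
    "\<And>t. 0 \<le> t \<Longrightarrow> (u t)\<^sup>2 + (u' t)\<^sup>2 \<ge> min (m1\<^sup>2 / 2) (3 / 4) * m1 / (m2 ^ 3 * l\<^sup>2)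
        * exp (2 * (\<kappa> * (t / 2 - (1 / 4 + Q * t / 2) / (l * m1)) - D * t))"
proof -
  have \<Phi>_cont: "continuous_on UNIV \<Phi>"
    using \<Phi>' DERIV_continuous_on by blast
  obtain M where M: "M 0 = 0" "\<And>t. (M has_real_derivative (sin (l * \<Phi> t))\<^sup>2) (at t)"
    by (rule antiderivative_real[of "\<lambda>t. (sin (l * \<Phi> t))\<^sup>2"]) (auto intro!: continuous_intros \<Phi>_cont)
  define s c where "s t = sin (l * \<Phi> t)" and "c t = cos (l * \<Phi> t)" for t
  \<comment> \<open>A primitive of \<open>b1\<close>: since \<open>w' = 2 q w\<close>, the logarithm
    integrates \<open>- q\<close>.\<close>
  define b where "b t = - D * t - ln (w t) / 2 + \<kappa> * M t" for t
  define b1 where "b1 t = - D - q t + \<kappa> * (s t)\<^sup>2" for t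
  define E where "E t = exp (b t)" for t
  define r where "r t = l * w t * c t + b1 t * s t" for t
  define U where "U t = s t * E t" for t
  define U1 where "U1 t = r t * E t" for t
  have s': "(s has_real_derivative l * w t * c t) (at t)" for t
    unfolding s_def c_def by (auto intro!: derivative_eq_intros \<Phi>')
  have c': "(c has_real_derivative - (l * w t * s t)) (at t)" for t
    unfolding s_def c_def by (auto intro!: derivative_eq_intros \<Phi>')
  have b': "(b has_real_derivative b1 t) (at t)" for t
  proof -
    have "w t \<noteq> 0" using w_pos[of t] by simp
    then show ?thesis unfolding b_def b1_def s_def
      by (auto intro!: derivative_eq_intros w' M w_pos)
  qed
  have E': "(E has_real_derivative b1 t * E t) (at t)" for t
    unfolding E_def by (auto intro!: derivative_eq_intros b')
  have b1': "(b1 has_real_derivative - q1 t + \<kappa> * (2 * s t * (l * w t * c t))) (at t)" for t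
    unfolding b1_def by (auto intro!: derivative_eq_intros q' s')
  have r': "(r has_real_derivative l * (2 * q t * w t) * c t - l * w t * (l * w t * s t)
      + ((- q1 t + \<kappa> * (2 * s t * (l * w t * c t))) * s t + b1 t * (l * w t * c t))) (at t)" for t
    unfolding r_def by (auto intro!: derivative_eq_intros w' s' c' b1')
  have U': "(U has_real_derivative U1 t) (at t)" for t
    unfolding U_def U1_def r_def by (auto intro!: derivative_eq_intros s' E' simp: algebra_simps)
  have speed: "((w t)\<^sup>2 + resonator l \<kappa> D t) * l\<^sup>2
      = l\<^sup>2 * (w t)\<^sup>2 - 4 * \<kappa> * l * w t * s t * c t + q1 t - (\<kappa> * (s t)\<^sup>2 - q t)\<^sup>2 + D\<^sup>2" for t
    unfolding resonator_def sin_double s_def[symmetric] c_def[symmetric]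
    using l by (simp add: field_simps power2_eq_square)
  have U1': "(U1 has_real_derivative - (2 * D) * U1 t - ((w t)\<^sup>2 + resonator l \<kappa> D t) * l\<^sup>2 * U t) (at t)" for t
  proof -
    have "(U1 has_real_derivative (l * (2 * q t * w t) * c t - l * w t * (l * w t * s t)
      + ((- q1 t + \<kappa> * (2 * s t * (l * w t * c t))) * s t + b1 t * (l * w t * c t))) * E t
      + r t * (b1 t * E t)) (at t)"
      unfolding U1_def by (auto intro!: derivative_eq_intros r' E')
    then show ?thesis unfolding speed U_def U1_def r_def b1_def
      by (rule DERIV_cong) (simp add: algebra_simps power2_eq_square)
  qed
  define N where "N = l * w 0 * E 0"
  have N: "0 < N" using l w_pos[of 0] by (simp add: N_def E_def)
  \<comment> \<open>The first entry serves where the cosine dominates. The second is what is left of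
    the squared sine after giving up the quarter that pays for
    \<open>(b1 t)\<^sup>2 \<le> (l / 2)\<^sup>2\<close>.\<close>
  define \<rho> where "\<rho> = min (m1\<^sup>2 / 2) (3 / 4)"
  have \<rho>: "0 < \<rho>" using m1_pos by (simp add: \<rho>_def)
  have lower: "(U t)\<^sup>2 + (U1 t)\<^sup>2 \<ge> \<rho> * (E t)\<^sup>2" for t
  proof -
    have "\<kappa> * (s t)\<^sup>2 \<le> \<kappa>" "0 \<le> \<kappa> * (s t)\<^sup>2"
      using \<kappa> by (auto intro!: mult_right_le_one_le simp: abs_square_le_1 s_def)
    then have "\<bar>b1 t\<bar> \<le> l / 2" unfolding b1_def using D small q_le[of t] by linarith
    then have "(b1 t)\<^sup>2 \<le> (l / 2)\<^sup>2" using l by (intro power2_le_iff_abs_le[THEN iffD2]) auto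
    then have 1: "(b1 t)\<^sup>2 * (s t)\<^sup>2 \<le> (l / 2)\<^sup>2 * (s t)\<^sup>2" by (intro mult_right_mono) auto
    have 2: "(r t)\<^sup>2 \<ge> (l * w t * c t)\<^sup>2 / 2 - (b1 t * s t)\<^sup>2"
    proof -
      \<comment> \<open>The identity behind this is \<open>(x + y)\<^sup>2 - x\<^sup>2 / 2 +
        y\<^sup>2 = 2 * (x / 2 + y)\<^sup>2\<close>.\<close>
      have "0 \<le> (l * w t * c t / 2 + b1 t * s t)\<^sup>2 * 2" by simp
      then show ?thesis unfolding r_def by (simp add: power2_eq_square algebra_simps)
    qed
    have 3: "l\<^sup>2 * \<rho> * (c t)\<^sup>2 \<le> (l * w t * c t)\<^sup>2 / 2"
    proof -
      have "\<rho> \<le> (w t)\<^sup>2 / 2"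
        using power_mono[OF w_ge[of t], of 2] m1_pos by (simp add: \<rho>_def)
      then have "l\<^sup>2 * \<rho> * (c t)\<^sup>2 \<le> l\<^sup>2 * ((w t)\<^sup>2 / 2) * (c t)\<^sup>2"
        by (intro mult_right_mono mult_left_mono) auto
      then show ?thesis by (simp add: power_mult_distrib)
    qed
    have 4: "l\<^sup>2 * \<rho> * (s t)\<^sup>2 \<le> l\<^sup>2 * (3 / 4) * (s t)\<^sup>2"
      by (intro mult_right_mono mult_left_mono) (auto simp: \<rho>_def)
    have "(s t)\<^sup>2 + (c t)\<^sup>2 = 1" by (simp add: s_def c_def)
    then have "l\<^sup>2 * \<rho> = l\<^sup>2 * \<rho> * (s t)\<^sup>2 + l\<^sup>2 * \<rho> * (c t)\<^sup>2" by (simp add: distrib_left[symmetric])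
    also have "\<dots> \<le> l\<^sup>2 * (s t)\<^sup>2 + (r t)\<^sup>2"
      using 1 2 3 4 by (simp add: power_mult_distrib power_divide)
    also have "\<dots> \<le> l\<^sup>2 * (s t)\<^sup>2 + l\<^sup>2 * (r t)\<^sup>2"
      using l by (simp add: mult_le_cancel_right1 power_le_one_iff one_le_power)
    finally have "l\<^sup>2 * \<rho> \<le> l\<^sup>2 * ((s t)\<^sup>2 + (r t)\<^sup>2)" by (simp add: distrib_left)
    then have "\<rho> \<le> (s t)\<^sup>2 + (r t)\<^sup>2" using l by (subst (asm) mult_le_cancel_left_pos) auto
    then have "\<rho> * (E t)\<^sup>2 \<le> ((s t)\<^sup>2 + (r t)\<^sup>2) * (E t)\<^sup>2" by (intro mult_right_mono) auto
    then show ?thesis by (simp add: U_def U1_def power_mult_distrib algebra_simps)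
  qed
  define u u' where "u t = U t / N" and "u' t = U1 t / N" for t
  show ?thesis
  proof (rule that[of u u'])
    have "U 0 = 0" "U1 0 = N" by (auto simp: U_def U1_def r_def s_def c_def N_def \<Phi>_0)
    moreover have "(u has_real_derivative u' t) (at t)" for t
      unfolding u_def u'_def by (intro DERIV_cdivide U')
    moreover have "(u' has_real_derivative - (2 * D) * u' t - ((w t)\<^sup>2 + resonator l \<kappa> D t) * l\<^sup>2 * u t) (at t)" for t
      using DERIV_cdivide[OF U1', of N t] unfolding u_def u'_def by (simp add: diff_divide_distrib)
    ultimately show "sine_like_solution (2 * D) (\<lambda>t. ((w t)\<^sup>2 + resonator l \<kappa> D t) * l\<^sup>2) u u'"
      unfolding sine_like_solution_def using N
      by (auto intro: has_field_derivative_at_within simp: u_def[of 0] u'_def[of 0])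
    fix t :: real assume t: "0 \<le> t"
    define X where "X = \<kappa> * (t / 2 - (1 / 4 + Q * t / 2) / (l * m1)) - D * t"
    have "\<kappa> * (t / 2 - (1 / 4 + Q * t / 2) / (l * m1)) \<le> \<kappa> * M t"
      using integral_sin_squared_lower[OF M(2,1)] l t \<kappa> by (intro mult_left_mono) auto
    moreover have "ln (w t) \<le> ln m2" "ln m1 \<le> ln (w 0)"
      using w_le[of t] w_pos[of t] m1_pos w_ge[of 0] by auto
    ultimately have "2 * (b t - b 0) \<ge> 2 * X + (ln m1 - ln m2)"
      unfolding b_def X_def using M(1) by (simp add: algebra_simps)
    then have "exp (2 * (b t - b 0)) \<ge> exp (2 * X + (ln m1 - ln m2))" by simp
    also have "exp (2 * X + (ln m1 - ln m2)) = exp (2 * X) * (m1 / m2)"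
      using m1_pos m2_pos by (simp add: exp_add exp_diff)
    also have "exp (2 * (b t - b 0)) = (E t)\<^sup>2 / (E 0)\<^sup>2"
      by (simp add: E_def exp_diff right_diff_distrib exp_double)
    finally have EE: "exp (2 * X) * (m1 / m2) \<le> (E t)\<^sup>2 / (E 0)\<^sup>2" .
    have w0: "(w 0)\<^sup>2 \<le> m2\<^sup>2" using w_pos[of 0] w_le[of 0] by (intro power_mono) auto
    \<comment> \<open>The factor \<open>m1 / m2\<close> comes from the logarithms in
      \<open>b\<close>, and \<open>l\<^sup>2 * m2\<^sup>2\<close> from the normalisation
      \<open>N\<close>.\<close>
    have "\<rho> * m1 / (m2 ^ 3 * l\<^sup>2) * exp (2 * X) = \<rho> / (l\<^sup>2 * m2\<^sup>2) * (exp (2 * X) * (m1 / m2))"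
      using m2_pos by (simp add: field_simps power2_eq_square power3_eq_cube)
    also have "\<dots> \<le> \<rho> / (l\<^sup>2 * (w 0)\<^sup>2) * ((E t)\<^sup>2 / (E 0)\<^sup>2)"
      using EE \<rho> l w0 w_pos[of 0] m1_pos m2_pos by (intro mult_mono frac_le mult_left_mono) auto
    also have "\<dots> = \<rho> * (E t)\<^sup>2 / N\<^sup>2" by (simp add: N_def power_mult_distrib)
    also have "\<dots> \<le> ((U t)\<^sup>2 + (U1 t)\<^sup>2) / N\<^sup>2" by (intro divide_right_mono lower) auto
    also have "\<dots> = (u t)\<^sup>2 + (u' t)\<^sup>2" by (simp add: u_def u'_def power_divide add_divide_distrib)
    finally show "(u t)\<^sup>2 + (u' t)\<^sup>2 \<ge> min (m1\<^sup>2 / 2) (3 / 4) * m1 / (m2 ^ 3 * l\<^sup>2)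
        * exp (2 * (\<kappa> * (t / 2 - (1 / 4 + Q * t / 2) / (l * m1)) - D * t))"
      by (simp add: X_def \<rho>_def)
  qed
qed

end

section \<open>Asymptotics at high frequency\<close>

context smooth_speed
begin

text \<open>The leading term of \<open>resonator_bound\<close> is
  \<open>2 * k * m2 * l powr (- \<alpha>)\<close> and the others are of lower order; the doubled
  constant absorbs them.\<close>

lemma resonator_small:
  fixes k \<alpha> \<delta> :: real
  assumes "0 < k" "0 < \<alpha>" "\<alpha> < 1"
  shows "\<forall>\<^sub>F l in at_top. \<forall>t. \<bar>resonator l (k * l powr (1 - \<alpha>)) (\<delta> * l powr (1 - \<alpha>)) t\<bar>
           \<le> 4 * k * m2 * l powr (- \<alpha>)"
proof -
  have "\<forall>\<^sub>F l in at_top. 2 * (k * l powr (1 - \<alpha>) / l) * m2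
      + (Q + (k * l powr (1 - \<alpha>) + Q)\<^sup>2 + (\<delta> * l powr (1 - \<alpha>))\<^sup>2) / l\<^sup>2 \<le> 4 * k * m2 * l powr (- \<alpha>)"
  proof (cases \<delta> "0::real" rule: linorder_cases)
  qed (use assms m2_pos in real_asymp)+
  with eventually_gt_at_top[of 0] show ?thesis
  proof eventually_elim
    case (elim l)
    then show ?case
      using assms by (auto intro!: order_trans[OF resonator_bound])
  qed
qed

text \<open>Again twice the leading term, which is
  \<open>4 * k * m2\<^sup>2 * l powr (1 - \<alpha>)\<close> and comes from differentiating the fast
  sine.\<close>

lemma resonator_deriv_small:
  fixes k \<alpha> :: real
  assumes "0 < k" "0 < \<alpha>" "\<alpha> < 1"
  shows "\<forall>\<^sub>F l in at_top. \<forall>t. \<bar>resonator_deriv l (k * l powr (1 - \<alpha>)) t\<bar> \<le> 8 * k * m2\<^sup>2 * l powr (1 - \<alpha>)"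
proof -
  have "\<forall>\<^sub>F l in at_top. 2 * (k * l powr (1 - \<alpha>) / l) * (2 * Q * m2 + 2 * l * m2\<^sup>2)
      + (Q + 2 * (k * l powr (1 - \<alpha>) + Q) * (k * l powr (1 - \<alpha>) * l * m2 + Q)) / l\<^sup>2
      \<le> 8 * k * m2\<^sup>2 * l powr (1 - \<alpha>)"
    using assms m2_pos by real_asymp
  with eventually_gt_at_top[of 0] show ?thesis
  proof eventually_elim
    case (elim l)
    then show ?case
      using assms by (auto intro!: order_trans[OF resonator_deriv_bound])
  qed
qed

text \<open>The exponent grows like a positive multiple of \<open>l powr (1 - \<alpha>)\<close>,
  which beats the same power divided by a logarithm and all polynomial factors. This is where
  \<open>2 * \<delta> < k\<close> enters.\<close>

lemma growth_eventually:
  fixes k \<alpha> \<delta> \<tau> T :: real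
  assumes "0 < k" "0 < \<alpha>" "\<alpha> < 1" "2 * \<delta> < k" "0 < \<tau>" "\<tau> \<le> T"
  shows "\<forall>\<^sub>F l in at_top. \<forall>t\<in>{\<tau>..T}.
    (1 + l)\<^sup>2 * exp (4 * l powr (1 - \<alpha>) / ln (2 + l)) <
    min (m1\<^sup>2 / 2) (3 / 4) * m1 / (m2 ^ 3 * l\<^sup>2)
      * exp (2 * (k * l powr (1 - \<alpha>) * (t / 2 - (1 / 4 + Q * t / 2) / (l * m1)) - \<delta> * l powr (1 - \<alpha>) * t))"
proof -
  \<comment> \<open>Worst cases over the time interval: the gain \<open>\<beta>\<close> at
    \<open>\<tau>\<close>, the loss \<open>C\<close> at \<open>T\<close>. The estimate is thereby
    uniform in \<open>t\<close>.\<close>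
  define \<beta> where "\<beta> = (k / 2 - \<delta>) * \<tau>"
  define C where "C = k * (1 / 4 + Q * T / 2) / m1"
  define \<rho> where "\<rho> = min (m1\<^sup>2 / 2) (3 / 4) * m1 / m2 ^ 3"
  have \<beta>: "0 < \<beta>" using assms by (simp add: \<beta>_def)
  have \<rho>: "0 < \<rho>" using m1_pos m2_pos by (simp add: \<rho>_def)
  have "\<forall>\<^sub>F l in at_top. (1 + l)\<^sup>2 * exp (4 * l powr (1 - \<alpha>) / ln (2 + l)) <
     \<rho> / l\<^sup>2 * exp (2 * (\<beta> * l powr (1 - \<alpha>) - C * l powr (- \<alpha>)))"
    using assms \<beta> \<rho> by real_asymp
  with eventually_gt_at_top[of 0] show ?thesis
  proof eventually_elim
    case (elim l)
    show ?case
    proof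
      fix t assume t: "t \<in> {\<tau>..T}"
      have "l powr (1 - \<alpha>) = l * l powr (- \<alpha>)" using elim by (simp add: powr_diff powr_minus divide_inverse)
      then have "k * l powr (1 - \<alpha>) * (t / 2 - (1 / 4 + Q * t / 2) / (l * m1)) - \<delta> * l powr (1 - \<alpha>) * t
        = (k / 2 - \<delta>) * t * l powr (1 - \<alpha>) - k * (1 / 4 + Q * t / 2) / m1 * l powr (- \<alpha>)"
        using elim m1_pos by (simp add: field_simps)
      moreover have "\<beta> * l powr (1 - \<alpha>) \<le> (k / 2 - \<delta>) * t * l powr (1 - \<alpha>)"
        unfolding \<beta>_def using t assms by (intro mult_right_mono mult_left_mono) auto
      moreover have "k * (1 / 4 + Q * t / 2) / m1 * l powr (- \<alpha>) \<le> C * l powr (- \<alpha>)"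
        unfolding C_def using t assms m1_pos Q_nonneg
        by (intro mult_right_mono divide_right_mono mult_left_mono add_left_mono) auto
      ultimately have "exp (2 * (\<beta> * l powr (1 - \<alpha>) - C * l powr (- \<alpha>))) \<le>
        exp (2 * (k * l powr (1 - \<alpha>) * (t / 2 - (1 / 4 + Q * t / 2) / (l * m1)) - \<delta> * l powr (1 - \<alpha>) * t))"
        by simp
      then have "\<rho> / l\<^sup>2 * exp (2 * (\<beta> * l powr (1 - \<alpha>) - C * l powr (- \<alpha>))) \<le> \<rho> / l\<^sup>2 *
        exp (2 * (k * l powr (1 - \<alpha>) * (t / 2 - (1 / 4 + Q * t / 2) / (l * m1)) - \<delta> * l powr (1 - \<alpha>) * t))"
        using \<rho> by (intro mult_left_mono) auto
      with elim show "(1 + l)\<^sup>2 * exp (4 * l powr (1 - \<alpha>) / ln (2 + l)) <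
        min (m1\<^sup>2 / 2) (3 / 4) * m1 / (m2 ^ 3 * l\<^sup>2)
        * exp (2 * (k * l powr (1 - \<alpha>) * (t / 2 - (1 / 4 + Q * t / 2) / (l * m1)) - \<delta> * l powr (1 - \<alpha>) * t))"
        by (simp add: \<rho>_def)
    qed
  qed
qed

end

text \<open>With \<open>p = 1 / g\<close>, the functions \<open>q = g' / (4 g)\<close>,
  \<open>q1\<close> and \<open>q2\<close> are polynomials in \<open>p\<close> and the derivatives of
  \<open>g\<close>, hence bounded; \<open>Q\<close> dominates all three at once.\<close>

lemma smooth_speed_sqrt:
  fixes g g1 g2 g3 :: "real \<Rightarrow> real"
  assumes g': "\<And>t. (g has_real_derivative g1 t) (at t)"
    and g1': "\<And>t. (g1 has_real_derivative g2 t) (at t)"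
    and g2': "\<And>t. (g2 has_real_derivative g3 t) (at t)"
    and B: "\<And>t. \<bar>g1 t\<bar> \<le> B" "\<And>t. \<bar>g2 t\<bar> \<le> B" "\<And>t. \<bar>g3 t\<bar> \<le> B"
    and m1: "0 < m1" and g_ge: "\<And>t. m1 \<le> g t" and g_le: "\<And>t. g t \<le> m2"
  obtains q q1 q2 \<Phi> Q where "smooth_speed (\<lambda>t. sqrt (g t)) q q1 q2 \<Phi> (sqrt m1) (sqrt m2) Q"
proof -
  define p where "p t = inverse (g t)" for t
  define P where "P = inverse m1"
  have gpos: "0 < g t" for t using m1 g_ge[of t] by simp
  have p: "\<bar>p t\<bar> \<le> P" for t
    unfolding p_def P_def using gpos[of t] g_ge[of t] m1 by (simp add: le_imp_inverse_le)
  have p': "(p has_real_derivative - (g1 t * (p t)\<^sup>2)) (at t)" for t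
    unfolding p_def using gpos[of t]
    by (auto intro!: derivative_eq_intros g' simp: power2_eq_square)
  define q where "q t = g1 t * p t / 4" for t
  define q1 where "q1 t = (g2 t * p t - g1 t * g1 t * (p t * p t)) / 4" for t
  define q2 where "q2 t = (g3 t * p t - 3 * (g1 t * g2 t * (p t * p t)) + 2 * (g1 t * g1 t * g1 t * (p t * p t * p t))) / 4" for t
  define Q where "Q = B * P + 3 * (B * B * (P * P)) + 2 * (B * B * B * (P * P * P))"
  have B0: "0 \<le> B" using B(1)[of 0] by linarith
  have P0: "0 \<le> P" using m1 by (simp add: P_def)
  have nn: "0 \<le> B * P" "0 \<le> B * B * (P * P)" "0 \<le> B * B * B * (P * P * P)" using B0 P0 by auto
  have 1: "\<bar>g1 t * p t\<bar> \<le> B * P" "\<bar>g2 t * p t\<bar> \<le> B * P" "\<bar>g3 t * p t\<bar> \<le> B * P"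
    "\<bar>g1 t * g1 t * (p t * p t)\<bar> \<le> B * B * (P * P)" "\<bar>g1 t * g2 t * (p t * p t)\<bar> \<le> B * B * (P * P)"
    "\<bar>g1 t * g1 t * g1 t * (p t * p t * p t)\<bar> \<le> B * B * B * (P * P * P)" for t
    by (intro abs_mult_le B p)+
  obtain \<Phi> where \<Phi>: "\<Phi> 0 = 0" "\<And>t. (\<Phi> has_real_derivative sqrt (g t)) (at t)"
  proof (rule antiderivative_real[of "\<lambda>t. sqrt (g t)"])
    have "continuous_on UNIV g" using g' DERIV_continuous_on by blast
    then show "continuous_on UNIV (\<lambda>t. sqrt (g t))" by (intro continuous_intros)
  qed (rule that)
  have "smooth_speed (\<lambda>t. sqrt (g t)) q q1 q2 \<Phi> (sqrt m1) (sqrt m2) Q"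
  proof
    fix t
    have "((\<lambda>t. sqrt (g t)) has_real_derivative inverse (sqrt (g t)) / 2 * g1 t) (at t)"
      using gpos[of t] by (auto intro!: derivative_eq_intros g')
    moreover have "inverse (sqrt (g t)) / 2 * g1 t = 2 * q t * sqrt (g t)"
    proof -
      have "g t = sqrt (g t) * sqrt (g t)" using gpos[of t] by simp
      then have "p t * sqrt (g t) = inverse (sqrt (g t))"
        unfolding p_def using gpos[of t] by (metis inverse_mult_distrib left_inverse less_irrefl mult.assoc mult.right_neutral real_sqrt_eq_zero_cancel_iff)
      then show ?thesis unfolding q_def by (simp add: mult_ac)
    qed
    ultimately show "((\<lambda>t. sqrt (g t)) has_real_derivative 2 * q t * sqrt (g t)) (at t)" by (simp only:)
    show "(q has_real_derivative q1 t) (at t)" unfolding q_def q1_def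
      by (rule DERIV_cong[OF DERIV_cdivide[OF DERIV_mult[OF g1' p']]])
         (simp add: power2_eq_square algebra_simps)
    have "((\<lambda>t. g2 t * p t - (g1 t * p t)\<^sup>2) has_real_derivative
       g3 t * p t + g2 t * (- (g1 t * (p t)\<^sup>2)) - 2 * (g1 t * p t) * (g2 t * p t + g1 t * (- (g1 t * (p t)\<^sup>2)))) (at t)"
      by (auto intro!: derivative_eq_intros g1' g2' p' simp: algebra_simps power2_eq_square)
    then have "((\<lambda>t. (g2 t * p t - (g1 t * p t)\<^sup>2) / 4) has_real_derivative
       (g3 t * p t + g2 t * (- (g1 t * (p t)\<^sup>2)) - 2 * (g1 t * p t) * (g2 t * p t + g1 t * (- (g1 t * (p t)\<^sup>2)))) / 4) (at t)"
      by (rule DERIV_cdivide)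
    moreover have "(\<lambda>t. (g2 t * p t - (g1 t * p t)\<^sup>2) / 4) = q1"
      by (simp add: fun_eq_iff q1_def power2_eq_square mult_ac)
    ultimately show "(q1 has_real_derivative q2 t) (at t)"
      by (simp add: q2_def power2_eq_square algebra_simps)
    show "(\<Phi> has_real_derivative sqrt (g t)) (at t)" by (rule \<Phi>)
    show "sqrt m1 \<le> sqrt (g t)" "sqrt (g t) \<le> sqrt m2" using g_ge g_le by auto
    have lin: "\<bar>(x - y) / 4\<bar> \<le> a + 3 * b + 2 * c"
      if "\<bar>x\<bar> \<le> a" "\<bar>y\<bar> \<le> b" "0 \<le> b" "0 \<le> c" for x y a b c :: real
      using that by (auto simp: abs_le_iff)
    have lin': "\<bar>(x - 3 * y + 2 * z) / 4\<bar> \<le> a + 3 * b + 2 * c"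
      if "\<bar>x\<bar> \<le> a" "\<bar>y\<bar> \<le> b" "\<bar>z\<bar> \<le> c" "0 \<le> b" "0 \<le> c" for x y z a b c :: real
      using that by (auto simp: abs_le_iff)
    show "\<bar>q1 t\<bar> \<le> Q" unfolding q1_def Q_def by (rule lin[OF 1(2,4) nn(2,3)])
    show "\<bar>q2 t\<bar> \<le> Q" unfolding q2_def Q_def by (rule lin'[OF 1(3,5,6) nn(2,3)])
    show "\<bar>q t\<bar> \<le> Q" unfolding q_def Q_def using 1(1)[of t] nn by linarith
  qed (use \<Phi>(1) m1 in auto)
  then show ?thesis by (rule that)
qed

text \<open>The scale \<open>r\<close> separates small increments, where the Lipschitz bound makes \<open>g\<close> negligible,
  from large ones, where \<open>V\<close> is absorbed by the margin \<open>\<eta> H\<close>.\<close>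

lemma holder_add_small_oscillation:
  fixes g V :: "real \<Rightarrow> real"
  assumes "\<bar>g t - g s\<bar> \<le> (1 - \<eta>) * H * \<bar>t - s\<bar> powr \<alpha>" "\<bar>g t - g s\<bar> \<le> B * \<bar>t - s\<bar>"
    and "\<bar>V t\<bar> \<le> A" "\<bar>V s\<bar> \<le> A" "\<bar>V t - V s\<bar> \<le> H / 2 * \<bar>t - s\<bar> powr \<alpha>"
    and "0 < r" "B * r powr (1 - \<alpha>) \<le> H / 2" "2 * A \<le> \<eta> * H * r powr \<alpha>"
    and "0 < \<alpha>" "\<alpha> < 1" "0 < \<eta>" "0 < H" "0 \<le> B"
  shows "\<bar>(g t + V t) - (g s + V s)\<bar> \<le> H * \<bar>t - s\<bar> powr \<alpha>"
proof (cases "\<bar>t - s\<bar> \<le> r")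
  case True
  have "\<bar>g t - g s\<bar> \<le> H / 2 * \<bar>t - s\<bar> powr \<alpha>"
  proof (cases "t = s")
    case False
    then have "B * \<bar>t - s\<bar> = B * \<bar>t - s\<bar> powr (1 - \<alpha>) * \<bar>t - s\<bar> powr \<alpha>"
      by (simp add: powr_add[symmetric] mult.assoc)
    also have "\<dots> \<le> B * r powr (1 - \<alpha>) * \<bar>t - s\<bar> powr \<alpha>"
      using True assms by (intro mult_right_mono mult_left_mono powr_mono2) auto
    also have "\<dots> \<le> H / 2 * \<bar>t - s\<bar> powr \<alpha>" using assms by (intro mult_right_mono) auto
    finally show ?thesis using assms by linarith
  qed simp
  then show ?thesis using assms(5) by linarith
next
  case False
  then have "\<eta> * H * r powr \<alpha> \<le> \<eta> * H * \<bar>t - s\<bar> powr \<alpha>"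
    using assms by (intro mult_left_mono powr_mono2) auto
  moreover have "(1 - \<eta>) * H * \<bar>t - s\<bar> powr \<alpha> = H * \<bar>t - s\<bar> powr \<alpha> - \<eta> * H * \<bar>t - s\<bar> powr \<alpha>"
    by (simp add: algebra_simps)
  ultimately show ?thesis using assms(1,3,4,8) by linarith
qed

section \<open>Uniqueness and stability of the fundamental solution\<close>

lemma sine_like_solution_continuous:
  assumes "sine_like_solution a c u u'"
  shows "continuous_on {0..} u" "continuous_on {0..} u'"
  using assms unfolding sine_like_solution_def continuous_on_eq_continuous_within
  by (auto intro: DERIV_continuous)

lemma sine_like_solution_bounded:
  assumes "sine_like_solution a c u u'"
  obtains M where "\<And>t. 0 \<le> t \<Longrightarrow> t \<le> T \<Longrightarrow> \<bar>u t\<bar> \<le> M"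
proof -
  have "continuous_on {0..T} u"
    using sine_like_solution_continuous(1)[OF assms] by (rule continuous_on_subset) auto
  then have "bounded (u ` {0..T})" by (intro compact_imp_bounded compact_continuous_image) auto
  then obtain M where "\<forall>x\<in>u ` {0..T}. norm x \<le> M" by (auto simp: bounded_iff)
  then show ?thesis by (intro that[of M]) auto
qed

lemma sine_like_solution_unique:
  assumes u: "sine_like_solution a c u u'" and v: "sine_like_solution a c v v'"
    and B: "\<And>t. 0 \<le> t \<Longrightarrow> \<bar>c t\<bar> \<le> B" and t: "0 \<le> t"
  shows "u t = v t" "u' t = v' t"
proof -
  obtain M where M: "\<And>s. 0 \<le> s \<Longrightarrow> s \<le> t \<Longrightarrow> \<bar>u s\<bar> \<le> M"
    using sine_like_solution_bounded[OF u] by blast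
  have "(u t - v t)\<^sup>2 + (u' t - v' t)\<^sup>2 \<le> (0 * M)\<^sup>2 * t * exp ((2 + B + 2 * \<bar>a\<bar>) * t)"
    by (rule sine_like_solution_dependence[OF u v B _ M t]) auto
  then show "u t = v t" "u' t = v' t" by (simp_all add: sum_power2_le_zero_iff)
qed

text \<open>By compactness the norm of \<open>(u, u')\<close> attains a minimum above
  \<open>sqrt \<theta>\<close> on the interval. A perturbation moving the pair by less than this gap
  \<open>e\<close> keeps the strict inequality.\<close>

lemma sine_like_solution_stable:
  assumes u: "sine_like_solution a c u u'"
    and B: "\<And>t. 0 \<le> t \<Longrightarrow> \<bar>c t\<bar> \<le> B"
    and \<theta>: "\<And>t. t \<in> {\<tau>..T} \<Longrightarrow> \<theta> < (u t)\<^sup>2 + (u' t)\<^sup>2" "0 \<le> \<theta>"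
    and \<tau>: "0 \<le> \<tau>" "\<tau> \<le> T"
  obtains \<epsilon> where "0 < \<epsilon>" "\<And>d v v' t. (\<And>t. 0 \<le> t \<Longrightarrow> \<bar>c t - d t\<bar> \<le> \<epsilon>) \<Longrightarrow> sine_like_solution a d v v'
      \<Longrightarrow> t \<in> {\<tau>..T} \<Longrightarrow> \<theta> < (v t)\<^sup>2 + (v' t)\<^sup>2"
proof -
  have "continuous_on {\<tau>..T} (\<lambda>t. norm (u t, u' t))"
    using sine_like_solution_continuous[OF u] \<tau>
    by (intro continuous_intros) (auto elim: continuous_on_subset)
  then obtain t0 where t0: "t0 \<in> {\<tau>..T}" "\<And>t. t \<in> {\<tau>..T} \<Longrightarrow> norm (u t0, u' t0) \<le> norm (u t, u' t)"
    using continuous_attains_inf[of "{\<tau>..T}" "\<lambda>t. norm (u t, u' t)"] \<tau> by auto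
  define e where "e = norm (u t0, u' t0) - sqrt \<theta>"
  have e: "0 < e" using \<theta>(1)[OF t0(1)] by (simp add: e_def norm_Pair)
  obtain M where M: "\<And>t. 0 \<le> t \<Longrightarrow> t \<le> T \<Longrightarrow> \<bar>u t\<bar> \<le> M"
    using sine_like_solution_bounded[OF u] by blast
  \<comment> \<open>\<open>B + 1\<close> bounds the perturbed coefficient, since
    \<open>\<epsilon>\<close> will be below 1.\<close>
  define W where "W = exp ((2 + (B + 1) + 2 * \<bar>a\<bar>) * T)"
  have "((\<lambda>\<epsilon>. (\<epsilon> * M)\<^sup>2 * T * W) \<longlongrightarrow> (0 * M)\<^sup>2 * T * W) (at_right 0)"
    by (intro tendsto_intros)
  then have "\<forall>\<^sub>F \<epsilon> in at_right 0. (\<epsilon> * M)\<^sup>2 * T * W < e\<^sup>2"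
    using e by (intro order_tendstoD(2)) auto
  moreover have "\<forall>\<^sub>F \<epsilon> in at_right 0. (0::real) < \<epsilon> \<and> \<epsilon> < 1"
    by (auto simp: eventually_at_right_field intro!: exI[of _ 1])
  ultimately have "\<forall>\<^sub>F \<epsilon> in at_right 0. 0 < \<epsilon> \<and> \<epsilon> < 1 \<and> (\<epsilon> * M)\<^sup>2 * T * W < e\<^sup>2"
    by eventually_elim auto
  then obtain \<epsilon> where \<epsilon>: "0 < \<epsilon>" "\<epsilon> < 1" "(\<epsilon> * M)\<^sup>2 * T * W < e\<^sup>2"
    using eventually_happens trivial_limit_at_right_real by blast
  show ?thesis
  proof (rule that[OF \<epsilon>(1)])
    fix d v v' t
    assume d: "\<And>t. 0 \<le> t \<Longrightarrow> \<bar>c t - d t\<bar> \<le> \<epsilon>" and v: "sine_like_solution a d v v'" and t: "t \<in> {\<tau>..T}"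
    have dB: "\<bar>d s\<bar> \<le> B + 1" if "0 \<le> s" for s using d[OF that] B[OF that] \<epsilon>(2) by linarith
    have "(u t - v t)\<^sup>2 + (u' t - v' t)\<^sup>2 \<le> (\<epsilon> * M)\<^sup>2 * T * W"
      unfolding W_def by (rule sine_like_solution_dependence[OF u v dB d M]) (use t \<tau> in auto)
    then have "sqrt ((u t - v t)\<^sup>2 + (u' t - v' t)\<^sup>2) < e"
      using \<epsilon>(3) e by (intro real_less_lsqrt) auto
    then have "norm ((u t, u' t) - (v t, v' t)) < e" by (simp add: norm_Pair)
    moreover have "norm (u t, u' t) \<le> norm ((u t, u' t) - (v t, v' t)) + norm (v t, v' t)"
      by (metis diff_add_cancel norm_triangle_ineq)
    ultimately have "sqrt \<theta> < norm (v t, v' t)" using t0(2)[OF t] unfolding e_def by linarith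
    then show "\<theta> < (v t)\<^sup>2 + (v' t)\<^sup>2" by (simp add: norm_Pair)
  qed
qed

section \<open>Uniform distance and density of resonant speeds\<close>

lemma unif_dist_upper:
  assumes "c \<in> PS \<mu>1 \<mu>2 \<alpha> H" "d \<in> PS \<mu>1 \<mu>2 \<alpha> H" "0 \<le> t"
  shows "\<bar>c t - d t\<bar> \<le> unif_dist c d"
  unfolding unif_dist_def
proof (rule cSUP_upper)
  show "bdd_above ((\<lambda>t. \<bar>c t - d t\<bar>) ` {0..})"
  proof (rule bdd_aboveI2)
    fix s :: real assume "s \<in> {0..}"
    then have "\<mu>1 \<le> c s" "c s \<le> \<mu>2" "\<mu>1 \<le> d s" "d s \<le> \<mu>2" using assms by (auto simp: PS_def)
    then show "\<bar>c s - d s\<bar> \<le> \<mu>2 - \<mu>1" by linarith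
  qed
qed (use assms in auto)

lemma unif_dist_least:
  assumes "\<And>t. 0 \<le> t \<Longrightarrow> \<bar>c t - d t\<bar> \<le> e"
  shows "unif_dist c d \<le> e"
  unfolding unif_dist_def by (rule cSUP_least) (use assms in auto)

text \<open>The exponents of \<open>l\<close> sum to 0 and those of \<open>\<mu>\<close> to
  \<open>(1 - \<alpha>) / 2 + \<alpha> = (1 + \<alpha>) / 2\<close>; this is the origin of the
  exponent in the bound on \<open>\<delta>\<close>.\<close>

lemma resonator_holder_constant:
  fixes k \<mu> \<alpha> l :: real
  assumes "0 < k" "0 < \<mu>" "0 < l"
  shows "(2 * (4 * k * sqrt \<mu> * l powr (- \<alpha>))) powr (1 - \<alpha>) * (8 * k * (sqrt \<mu>)\<^sup>2 * l powr (1 - \<alpha>)) powr \<alpha>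
    = 8 * k * \<mu> powr ((1 + \<alpha>) / 2)"
proof -
  have "(2 * (4 * k * sqrt \<mu> * l powr (- \<alpha>))) powr (1 - \<alpha>) * (8 * k * (sqrt \<mu>)\<^sup>2 * l powr (1 - \<alpha>)) powr \<alpha>
    = ((8 * k) * (\<mu> powr (1 / 2)) * l powr (- \<alpha>)) powr (1 - \<alpha>) * ((8 * k) * \<mu> * l powr (1 - \<alpha>)) powr \<alpha>"
    using assms by (simp add: powr_half_sqrt mult.assoc)
  also have "\<dots> = ((8 * k) powr (1 - \<alpha>) * (8 * k) powr \<alpha>) * (\<mu> powr (1 / 2 * (1 - \<alpha>)) * \<mu> powr \<alpha>)
      * (l powr (- \<alpha> * (1 - \<alpha>)) * l powr ((1 - \<alpha>) * \<alpha>))"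
    using assms by (simp only: powr_mult powr_powr mult_ac)
  also have "(8 * k) powr (1 - \<alpha>) * (8 * k) powr \<alpha> = 8 * k"
    using assms by (simp add: powr_add[symmetric])
  also have "\<mu> powr (1 / 2 * (1 - \<alpha>)) * \<mu> powr \<alpha> = \<mu> powr ((1 + \<alpha>) / 2)"
    by (simp add: powr_add[symmetric] field_simps)
  also have "l powr (- \<alpha> * (1 - \<alpha>)) * l powr ((1 - \<alpha>) * \<alpha>) = 1"
    using assms by (simp add: powr_add[symmetric])
  finally show ?thesis by simp
qed

text \<open>First \<open>c\<close> is contracted towards a constant to gain room in its range and
  Hoelder constant, then it is smoothed, and finally the resonator is added.\<close>

lemma resonant_speed_near:
  fixes \<mu>1 \<mu>2 \<alpha> H \<delta> \<epsilon> \<tau> T :: real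
  assumes \<mu>: "0 < \<mu>1" "\<mu>1 < \<mu>2" and \<alpha>: "0 < \<alpha>" "\<alpha> < 1" and H: "0 < H"
    and \<delta>: "0 \<le> \<delta>" "\<delta> < H / (32 * \<mu>2 powr ((1 + \<alpha>) / 2))"
    and c: "c \<in> PS \<mu>1 \<mu>2 \<alpha> H" and \<epsilon>: "0 < \<epsilon>" and \<tau>: "0 < \<tau>" "\<tau> \<le> T"
  shows "\<forall>\<^sub>F l in at_top. \<exists>c'\<in>PS \<mu>1 \<mu>2 \<alpha> H. unif_dist c c' < \<epsilon> \<and>
    (\<exists>u u'. sine_like_solution (2 * (\<delta> * l powr (1 - \<alpha>))) (\<lambda>t. c' t * l\<^sup>2) u u' \<and>
      (\<forall>t\<in>{\<tau>..T}. (1 + l)\<^sup>2 * exp (4 * l powr (1 - \<alpha>) / ln (2 + l)) < (u t)\<^sup>2 + (u' t)\<^sup>2))"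
proof -
  define d where "d = (\<mu>2 - \<mu>1) / 2"
  have d: "0 < d" using \<mu> by (simp add: d_def)
  define \<eta> where "\<eta> = min (1 / 2) (\<epsilon> / (4 * d))"
  have \<eta>: "0 < \<eta>" "\<eta> < 1" using \<epsilon> d by (auto simp: \<eta>_def)
  have "\<eta> * d \<le> \<epsilon> / (4 * d) * d" using d by (intro mult_right_mono) (auto simp: \<eta>_def)
  then have \<eta>d: "\<eta> * d \<le> \<epsilon> / 4" using d by simp
  have \<eta>d0: "0 < \<eta> * d" using \<eta> d by simp
  \<comment> \<open>Convex combination with the midpoint \<open>\<mu>1 + d\<close> of the admissible
    range: it frees a margin \<open>\<eta> * d\<close> at both ends and lowers the Hoelder constant
    to \<open>(1 - \<eta>) * H\<close>.\<close>
  define C where "C t = (1 - \<eta>) * c (max t 0) + \<eta> * (\<mu>1 + d)" for t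
  have c_bd: "\<mu>1 \<le> c t" "c t \<le> \<mu>2" if "0 \<le> t" for t using c that by (auto simp: PS_def)
  have c_hol: "\<bar>c t - c s\<bar> \<le> H * \<bar>t - s\<bar> powr \<alpha>" if "0 \<le> t" "0 \<le> s" for t s
    using c that by (auto simp: PS_def)
  have C_ge: "\<mu>1 + \<eta> * d \<le> C t" for t
  proof -
    have "(1 - \<eta>) * \<mu>1 \<le> (1 - \<eta>) * c (max t 0)" using c_bd[of "max t 0"] \<eta> by (intro mult_left_mono) auto
    then show ?thesis by (simp add: C_def algebra_simps)
  qed
  have C_le: "C t \<le> \<mu>2 - \<eta> * d" for t
  proof -
    have "(1 - \<eta>) * c (max t 0) \<le> (1 - \<eta>) * \<mu>2" using c_bd[of "max t 0"] \<eta> by (intro mult_left_mono) auto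
    moreover have "\<mu>2 = \<mu>1 + 2 * d" by (simp add: d_def field_simps)
    ultimately show ?thesis by (simp add: C_def algebra_simps)
  qed
  have C_hol: "\<bar>C t - C s\<bar> \<le> (1 - \<eta>) * H * \<bar>t - s\<bar> powr \<alpha>" for t s
  proof -
    have "\<bar>C t - C s\<bar> = (1 - \<eta>) * \<bar>c (max t 0) - c (max s 0)\<bar>"
      using \<eta> by (simp add: C_def right_diff_distrib[symmetric] abs_mult)
    also have "\<dots> \<le> (1 - \<eta>) * (H * \<bar>max t 0 - max s 0\<bar> powr \<alpha>)"
      using \<eta> by (intro mult_left_mono c_hol) auto
    also have "\<dots> \<le> (1 - \<eta>) * (H * \<bar>t - s\<bar> powr \<alpha>)"
      using \<eta> \<alpha> H by (intro mult_left_mono powr_mono2) auto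
    finally show ?thesis by (simp add: mult.assoc)
  qed
  have C_c: "\<bar>C t - c t\<bar> \<le> \<epsilon> / 4" if "0 \<le> t" for t
  proof -
    have "C t - c t = \<eta> * (\<mu>1 + d - c t)" using that by (simp add: C_def algebra_simps)
    then have "\<bar>C t - c t\<bar> = \<eta> * \<bar>\<mu>1 + d - c t\<bar>" using \<eta> by (simp add: abs_mult)
    also have "\<dots> \<le> \<eta> * d" using \<eta> c_bd[OF that] by (intro mult_left_mono) (auto simp: d_def field_simps abs_le_iff)
    finally show ?thesis using \<eta>d by simp
  qed
  have e4: "0 < \<epsilon> / 4" and K: "0 \<le> (1 - \<eta>) * H" using \<epsilon> \<eta> H by auto
  obtain g g1 g2 g3 B where g': "\<And>t. (g has_real_derivative g1 t) (at t)"
    and g1': "\<And>t. (g1 has_real_derivative g2 t) (at t)"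
    and g2': "\<And>t. (g2 has_real_derivative g3 t) (at t)"
    and B: "\<And>t. \<bar>g1 t\<bar> \<le> B" "\<And>t. \<bar>g2 t\<bar> \<le> B" "\<And>t. \<bar>g3 t\<bar> \<le> B"
    and g_ge: "\<And>t. \<mu>1 + \<eta> * d \<le> g t" and g_le: "\<And>t. g t \<le> \<mu>2 - \<eta> * d"
    and g_hol: "\<And>t s. \<bar>g t - g s\<bar> \<le> (1 - \<eta>) * H * \<bar>t - s\<bar> powr \<alpha>"
    and g_C: "\<And>t. \<bar>g t - C t\<bar> \<le> \<epsilon> / 4"
    by (rule smooth_holder_approximation[OF C_ge C_le C_hol \<alpha>(1) K e4], rule that)
  have g_ge': "\<mu>1 \<le> g t" and g_le': "g t \<le> \<mu>2" for t using g_ge[of t] g_le[of t] \<eta>d0 by auto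
  obtain q q1 q2 \<Phi> Q where ss: "smooth_speed (\<lambda>t. sqrt (g t)) q q1 q2 \<Phi> (sqrt \<mu>1) (sqrt \<mu>2) Q"
    by (rule smooth_speed_sqrt[OF g' g1' g2' B \<mu>(1) g_ge' g_le'])
  interpret smooth_speed "\<lambda>t. sqrt (g t)" q q1 q2 \<Phi> "sqrt \<mu>1" "sqrt \<mu>2" Q by (rule ss)
  have B0: "0 \<le> B" using B(1)[of 0] by linarith
  define r where "r = (H / (2 * (B + 1))) powr (1 / (1 - \<alpha>))"
  have r: "0 < r" using H B0 by (simp add: r_def)
  have "r powr (1 - \<alpha>) = H / (2 * (B + 1))" using H B0 \<alpha> by (simp add: r_def powr_powr)
  then have "B * r powr (1 - \<alpha>) = H / 2 * (B / (B + 1))" by simp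
  also have "\<dots> \<le> H / 2" using H B0 by (intro mult_right_le_one_le) auto
  finally have rB: "B * r powr (1 - \<alpha>) \<le> H / 2" .
  \<comment> \<open>This gives the resonator exactly the Hoelder constant \<open>H / 2\<close>, and
    \<open>2 * \<delta> < k\<close> becomes the hypothesis with its constant 32.\<close>
  define k where "k = H / (16 * \<mu>2 powr ((1 + \<alpha>) / 2))"
  have k: "0 < k" using H \<mu> by (simp add: k_def)
  have k\<delta>: "2 * \<delta> < k" using \<delta>(2) by (simp add: k_def)
  have kH: "8 * k * \<mu>2 powr ((1 + \<alpha>) / 2) = H / 2" using \<mu> by (simp add: k_def)
  \<comment> \<open>Three demands on the amplitude: stay inside the range, spend at most a quarter
    of \<open>\<epsilon>\<close>, and fit the Hoelder margin at scale \<open>r\<close>.\<close>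
  define \<theta> where "\<theta> = min (\<eta> * d) (min (\<epsilon> / 4) (\<eta> * H * r powr \<alpha> / 2))"
  have \<theta>: "0 < \<theta>" using \<eta>d0 \<epsilon> \<eta> H r by (simp add: \<theta>_def)
  have ev1: "\<forall>\<^sub>F l in at_top. 4 * k * sqrt \<mu>2 * l powr (- \<alpha>) < \<theta>"
    using k \<alpha> \<theta> by real_asymp
  have ev2: "\<forall>\<^sub>F l in at_top. \<delta> * l powr (1 - \<alpha>) + k * l powr (1 - \<alpha>) + Q \<le> l / 2"
  proof -
    have "\<forall>\<^sub>F l in at_top. (\<delta> + k) * l powr (1 - \<alpha>) + Q \<le> l / 2"
      using k \<delta>(1) \<alpha> by real_asymp
    then show ?thesis by (simp add: distrib_right)
  qed
  show ?thesis
    using resonator_small[OF k \<alpha>, of \<delta>] resonator_deriv_small[OF k \<alpha>]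
      growth_eventually[OF k \<alpha> k\<delta> \<tau>] ev1 ev2 eventually_ge_at_top[of 1]
  proof eventually_elim
    case (elim l)
    define \<kappa> D where "\<kappa> = k * l powr (1 - \<alpha>)" and "D = \<delta> * l powr (1 - \<alpha>)"
    define A where "A = 4 * k * sqrt \<mu>2 * l powr (- \<alpha>)"
    define V where "V = resonator l \<kappa> D"
    define c' where "c' t = g t + V t" for t
    have V: "\<bar>V t\<bar> \<le> A" for t using elim(1) by (simp add: V_def \<kappa>_def D_def A_def)
    have A: "A \<le> \<eta> * d" "A < \<epsilon> / 4" "2 * A \<le> \<eta> * H * r powr \<alpha>"
      using elim(4) by (auto simp: A_def \<theta>_def)
    have V_hol: "\<bar>V t - V s\<bar> \<le> H / 2 * \<bar>t - s\<bar> powr \<alpha>" for t s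
    proof -
      have "\<bar>V t - V s\<bar> \<le> (2 * A) powr (1 - \<alpha>) * (8 * k * (sqrt \<mu>2)\<^sup>2 * l powr (1 - \<alpha>)) powr \<alpha> * \<bar>t - s\<bar> powr \<alpha>"
      proof (rule holder_of_bounded_derivative[OF _ V])
        show "(V has_real_derivative resonator_deriv l \<kappa> t) (at t)" for t
          unfolding V_def by (rule resonator_has_derivative)
        show "\<bar>resonator_deriv l \<kappa> t\<bar> \<le> 8 * k * (sqrt \<mu>2)\<^sup>2 * l powr (1 - \<alpha>)" for t
          using elim(2) by (simp add: \<kappa>_def)
      qed (use \<alpha> in auto)
      also have "(2 * A) powr (1 - \<alpha>) * (8 * k * (sqrt \<mu>2)\<^sup>2 * l powr (1 - \<alpha>)) powr \<alpha> = H / 2"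
        unfolding A_def using resonator_holder_constant[of k \<mu>2 l \<alpha>] k \<mu> elim(6) kH by simp
      finally show ?thesis .
    qed
    have c'_hol: "\<bar>c' t - c' s\<bar> \<le> H * \<bar>t - s\<bar> powr \<alpha>" for t s
      unfolding c'_def
      by (rule holder_add_small_oscillation[OF g_hol lipschitz_of_bounded_derivative[OF g' B(1)] V V V_hol r rB A(3)])
         (use \<alpha> \<eta> H B0 in auto)
    have c'_bd: "\<mu>1 \<le> c' t" "c' t \<le> \<mu>2" for t
      unfolding c'_def by (use V[of t] A(1) g_ge[of t] g_le[of t] in linarith)+
    have "c' \<in> PS \<mu>1 \<mu>2 \<alpha> H" using c'_hol c'_bd by (simp add: PS_def)
    moreover have "unif_dist c c' < \<epsilon>"
    proof -
      have "unif_dist c c' \<le> 3 * (\<epsilon> / 4)"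
      proof (rule unif_dist_least)
        fix t :: real assume "0 \<le> t"
        then show "\<bar>c t - c' t\<bar> \<le> 3 * (\<epsilon> / 4)"
          using C_c[of t] g_C[of t] V[of t] A(2) unfolding c'_def by linarith
      qed
      then show ?thesis using \<epsilon> by linarith
    qed
    moreover obtain u u' where
      u: "sine_like_solution (2 * D) (\<lambda>t. ((sqrt (g t))\<^sup>2 + resonator l \<kappa> D t) * l\<^sup>2) u u'"
      and growth: "\<And>t. 0 \<le> t \<Longrightarrow> (u t)\<^sup>2 + (u' t)\<^sup>2 \<ge>
        min ((sqrt \<mu>1)\<^sup>2 / 2) (3 / 4) * sqrt \<mu>1 / (sqrt \<mu>2 ^ 3 * l\<^sup>2)
        * exp (2 * (\<kappa> * (t / 2 - (1 / 4 + Q * t / 2) / (l * sqrt \<mu>1)) - D * t))"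
    proof (rule resonance_growth[of l \<kappa> D])
      show "1 \<le> l" "0 \<le> \<kappa>" "0 \<le> D" "D + \<kappa> + Q \<le> l / 2"
        using elim k \<delta>(1) by (auto simp: \<kappa>_def D_def)
    qed (rule that)
    have "(\<lambda>t. ((sqrt (g t))\<^sup>2 + resonator l \<kappa> D t) * l\<^sup>2) = (\<lambda>t. c' t * l\<^sup>2)"
      using g_ge' \<mu>(1) by (auto simp: fun_eq_iff c'_def V_def intro: order_trans less_imp_le)
    with u have "sine_like_solution (2 * D) (\<lambda>t. c' t * l\<^sup>2) u u'" by simp
    moreover have "(1 + l)\<^sup>2 * exp (4 * l powr (1 - \<alpha>) / ln (2 + l)) < (u t)\<^sup>2 + (u' t)\<^sup>2"
      if "t \<in> {\<tau>..T}" for t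
    proof -
      have "0 \<le> t" using that \<tau> by auto
      from less_le_trans[OF bspec[OF elim(3) that] growth[OF this, unfolded \<kappa>_def D_def]] show ?thesis .
    qed
    ultimately show ?case unfolding D_def by blast
  qed
qed

section \<open>Genericity\<close>

text \<open>The rate \<open>k + 1\<close> later compensates the weights \<open>1 / (k + 1)\<close>
  of the series, and it makes the selected frequencies positive.\<close>

lemma unbounded_subsequence:
  fixes lam :: "nat \<Rightarrow> real"
  assumes "filterlim lam at_top sequentially"
  obtains j :: "nat \<Rightarrow> nat" where "strict_mono j" "\<And>k. real k + 1 \<le> lam (j k)"
proof -
  have "\<exists>N. \<forall>i\<ge>N. real k + 1 \<le> lam i" for k
    using assms by (auto simp: filterlim_at_top eventually_sequentially)
  then obtain f where f: "\<And>k i. f k \<le> i \<Longrightarrow> real k + 1 \<le> lam i" by metis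
  define j where "j k = k + (\<Sum>i\<le>k. f i)" for k
  have "strict_mono j" by (rule strict_mono_Suc_iff[THEN iffD2]) (simp add: j_def)
  moreover have "f k \<le> j k" for k
    unfolding j_def using member_le_sum[of k "{..k}" f] by simp
  ultimately show ?thesis using f that by blast
qed

lemma PS_speed_bounded:
  assumes "c \<in> PS \<mu>1 \<mu>2 \<alpha> H" "0 < \<mu>1" "0 \<le> t"
  shows "\<bar>c t * l\<^sup>2\<bar> \<le> \<mu>2 * l\<^sup>2"
  using assms by (auto simp: PS_def abs_mult intro!: mult_right_mono) 

lemma PS_continuous_on:
  assumes "c \<in> PS \<mu>1 \<mu>2 \<alpha> H" "0 < \<alpha>"
  shows "continuous_on {0..} c"
  by (rule holder_continuous_on[of _ _ H \<alpha>]) (use assms in \<open>auto simp: PS_def\<close>)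

theorem mainTheorem2:
  fixes lam :: "nat \<Rightarrow> real"
    and \<mu>1 \<mu>2 \<alpha> H \<delta> \<sigma> s S :: real
  assumes "unbounded_discrete_mult_op lam"
    and "0 < \<mu>1" "\<mu>1 < \<mu>2" "0 < \<alpha>" "\<alpha> < 1" "0 < H"
    and "0 \<le> \<delta>" "\<delta> < H / (32 * \<mu>2 powr ((1 + \<alpha>) / 2))"
    and "2 * \<sigma> = 1 - \<alpha>"
    and "s = 1 / (1 - \<alpha>)" "S = 1 / (1 - \<alpha>)"
  shows "residual_in (PS \<mu>1 \<mu>2 \<alpha> H)
           {c \<in> PS \<mu>1 \<mu>2 \<alpha> H. \<exists>u u'. very_weak_solution lam \<delta> \<sigma> c u u' \<and>
              (\<lambda>i. u i 0) \<in> G_pos lam s (1/2) \<and> (\<lambda>i. u' i 0) \<in> G_pos lam s 0 \<and>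
              (\<forall>t>0. \<not> ((\<lambda>i. u i t) \<in> G_neg lam S (1/2) \<and>
                         (\<lambda>i. u' i t) \<in> G_neg lam S 0))}"
proof -
  let ?PS = "PS \<mu>1 \<mu>2 \<alpha> H"
  note \<mu> = assms(2,3) and \<alpha> = assms(4,5) and H = assms(6) and \<delta> = assms(7,8)
  have lam_nonneg: "0 \<le> lam i" for i using assms(1) by (auto simp: unbounded_discrete_mult_op_def)
  have lam_top: "filterlim lam at_top sequentially"
    using assms(1) by (auto simp: unbounded_discrete_mult_op_def)
  obtain j where j: "strict_mono j" and j_lam: "\<And>k. real k + 1 \<le> lam (j k)"
    using unbounded_subsequence[OF lam_top] by blast
  define X where "X i = lam i powr (1 - \<alpha>) / ln (2 + lam i)" for i
  define fundamental where "fundamental c i u u' \<longleftrightarrow>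
      sine_like_solution (2 * (\<delta> * lam i powr (1 - \<alpha>))) (\<lambda>t. c t * (lam i)\<^sup>2) u u'" for c i u u'
  \<comment> \<open>One half of the exponent pays for the squared coefficient of the series, the
    other for the weight of \<open>G_neg\<close>; the polynomial factor beats
    \<open>(k + 1)\<^sup>2\<close>.\<close>
  define \<theta> where "\<theta> i = (1 + lam i)\<^sup>2 * exp (4 * X i)" for i
  \<comment> \<open>Compact intervals, as stability requires, which exhaust the positive
    half-line.\<close>
  define window where "window n = {1 / (real n + 1)..real n + 1}" for n
  have window: "0 < 1 / (real n + 1)" "1 / (real n + 1) \<le> real n + 1" for n
    by (auto simp: divide_le_eq intro: order_trans[OF _ mult_mono[of 1 _ 1]])
  \<comment> \<open>The fundamental solution is unique, so quantifying over all of them avoids a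
    choice. The condition \<open>k \<ge> n\<close> forces infinitely many frequencies in the
    intersection.\<close>
  define U where "U n = {c \<in> ?PS. \<exists>k\<ge>n. \<forall>u u'. fundamental c (j k) u u' \<longrightarrow>
      (\<forall>t\<in>window n. \<theta> (j k) < (u t)\<^sup>2 + (u' t)\<^sup>2)}" for n
  have ex: "\<exists>u u'. fundamental c i u u'" if c: "c \<in> ?PS" for c i
  proof -
    have "continuous_on {0..} (\<lambda>t. c t * (lam i)\<^sup>2)"
      using PS_continuous_on[OF c \<alpha>(1)] by (intro continuous_intros)
    then show ?thesis unfolding fundamental_def
      using sine_like_solution_exists PS_speed_bounded[OF c \<mu>(1)] by metis
  qed
  have "open_in_space ?PS (U n)" for n
    unfolding open_in_space_def
  proof (intro conjI ballI)
    show "U n \<subseteq> ?PS" by (auto simp: U_def)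
    fix c assume "c \<in> U n"
    then obtain k where c: "c \<in> ?PS" and k: "n \<le> k"
      and grow: "\<And>u u' t. fundamental c (j k) u u' \<Longrightarrow> t \<in> window n \<Longrightarrow> \<theta> (j k) < (u t)\<^sup>2 + (u' t)\<^sup>2"
      by (auto simp: U_def)
    obtain u u' where u: "fundamental c (j k) u u'" using ex[OF c] by blast
    obtain \<epsilon> where \<epsilon>: "0 < \<epsilon>" and stable: "\<And>d v v' t. (\<And>t. 0 \<le> t \<Longrightarrow> \<bar>c t * (lam (j k))\<^sup>2 - d t\<bar> \<le> \<epsilon>) \<Longrightarrow>
        sine_like_solution (2 * (\<delta> * lam (j k) powr (1 - \<alpha>))) d v v' \<Longrightarrow>
        t \<in> {1 / (real n + 1)..real n + 1} \<Longrightarrow> \<theta> (j k) < (v t)\<^sup>2 + (v' t)\<^sup>2"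
    proof (rule sine_like_solution_stable[OF u[unfolded fundamental_def] PS_speed_bounded[OF c \<mu>(1)]])
      show "\<theta> (j k) < (u t)\<^sup>2 + (u' t)\<^sup>2" if "t \<in> {1 / (real n + 1)..real n + 1}" for t
        using grow[OF u] that by (simp add: window_def)
      show "0 \<le> \<theta> (j k)" by (simp add: \<theta>_def)
    qed (use window[of n] that in auto)
    \<comment> \<open>In the scalar equation the speed is multiplied by
      \<open>(lam (j k))\<^sup>2\<close>.\<close>
    define e where "e = \<epsilon> / (lam (j k))\<^sup>2"
    have lpos: "0 < lam (j k)" using j_lam[of k] by simp
    have "0 < e" using \<epsilon> lpos by (simp add: e_def)
    moreover have "c' \<in> U n" if c': "c' \<in> ?PS" and dist: "unif_dist c c' < e" for c'
    proof -
      have close: "\<bar>c t * (lam (j k))\<^sup>2 - c' t * (lam (j k))\<^sup>2\<bar> \<le> \<epsilon>" if "0 \<le> t" for t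
      proof -
        have "\<bar>c t * (lam (j k))\<^sup>2 - c' t * (lam (j k))\<^sup>2\<bar> = \<bar>c t - c' t\<bar> * (lam (j k))\<^sup>2"
          by (simp add: left_diff_distrib[symmetric] abs_mult)
        also have "\<dots> \<le> e * (lam (j k))\<^sup>2"
          using unif_dist_upper[OF c c' that] dist by (intro mult_right_mono) auto
        also have "\<dots> = \<epsilon>" using lpos by (simp add: e_def)
        finally show ?thesis .
      qed
      have "\<theta> (j k) < (v t)\<^sup>2 + (v' t)\<^sup>2" if "fundamental c' (j k) v v'" "t \<in> window n" for v v' t
        by (rule stable[OF close that(1)[unfolded fundamental_def] that(2)[unfolded window_def]])
      with k c' show ?thesis unfolding U_def by blast
    qed
    ultimately show "\<exists>\<epsilon>>0. \<forall>c'\<in>?PS. unif_dist c c' < \<epsilon> \<longrightarrow> c' \<in> U n" by blast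
  qed
  moreover have "dense_in_space ?PS (U n)" for n
    unfolding dense_in_space_def
  proof (intro ballI allI impI)
    fix c and \<epsilon> :: real assume c: "c \<in> ?PS" and \<epsilon>: "0 < \<epsilon>"
    have "filterlim (\<lambda>k. lam (j k)) at_top sequentially"
      by (rule filterlim_compose[OF lam_top filterlim_subseq[OF j]])
    from eventually_compose_filterlim[OF resonant_speed_near[OF \<mu> \<alpha> H \<delta> c \<epsilon> window[of n]] this]
    have "\<forall>\<^sub>F k in sequentially. \<exists>c'\<in>?PS. unif_dist c c' < \<epsilon> \<and> (\<exists>u u'. fundamental c' (j k) u u' \<and>
        (\<forall>t\<in>window n. \<theta> (j k) < (u t)\<^sup>2 + (u' t)\<^sup>2))"
      by (simp add: fundamental_def window_def \<theta>_def X_def)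
    then obtain k where k: "n \<le> k" and "\<exists>c'\<in>?PS. unif_dist c c' < \<epsilon> \<and> (\<exists>u u'. fundamental c' (j k) u u' \<and>
        (\<forall>t\<in>window n. \<theta> (j k) < (u t)\<^sup>2 + (u' t)\<^sup>2))"
      unfolding eventually_sequentially by (meson nle_le)
    then obtain c' u u' where c': "c' \<in> ?PS" and dist: "unif_dist c c' < \<epsilon>"
      and u: "fundamental c' (j k) u u'" and grow: "\<And>t. t \<in> window n \<Longrightarrow> \<theta> (j k) < (u t)\<^sup>2 + (u' t)\<^sup>2"
      by blast
    have "\<theta> (j k) < (v t)\<^sup>2 + (v' t)\<^sup>2" if v: "fundamental c' (j k) v v'" and t: "t \<in> window n" for v v' t
    proof -
      have "0 \<le> t" using t window(1)[of n] unfolding window_def by (meson atLeastAtMost_iff less_imp_le order_trans)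
      note sine_like_solution_unique[OF u[unfolded fundamental_def] v[unfolded fundamental_def]
          PS_speed_bounded[OF c' \<mu>(1)] this]
      with grow[OF t] show ?thesis by simp
    qed
    with c' k have "c' \<in> U n" unfolding U_def by blast
    with dist show "\<exists>c'\<in>U n. unif_dist c c' < \<epsilon>" by blast
  qed
  moreover have "\<exists>u u'. very_weak_solution lam \<delta> \<sigma> c u u' \<and>
              (\<lambda>i. u i 0) \<in> G_pos lam s (1/2) \<and> (\<lambda>i. u' i 0) \<in> G_pos lam s 0 \<and>
              (\<forall>t>0. \<not> ((\<lambda>i. u i t) \<in> G_neg lam S (1/2) \<and>
                         (\<lambda>i. u' i t) \<in> G_neg lam S 0))"
    if c: "c \<in> ?PS" and cU: "\<And>n. c \<in> U n" for c
  proof -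
    obtain v v' where v: "\<And>i. fundamental c i (v i) (v' i)" using ex[OF c] by metis
    have v_0: "v i 0 = 0" "v' i 0 = 1" for i using v[of i] by (auto simp: fundamental_def sine_like_solution_def)
    \<comment> \<open>The initial position vanishes and the initial velocity is \<open>a\<close>.
      The exponential cancels the weight of \<open>G_pos\<close>, leaving the summable squares of
      \<open>1 / (k + 1)\<close>.\<close>
    define a where "a i = (if i \<in> range j then exp (- X i) / (real (inv j i) + 1) else 0)" for i
    have a_j: "a (j k) = exp (- X (j k)) / (real k + 1)" for k
      using strict_mono_imp_inj_on[OF j] by (simp add: a_def)
    define u where "u i t = a i * v i t" for i t
    define u' where "u' i t = a i * v' i t" for i t
    have "very_weak_solution lam \<delta> \<sigma> c u u'"
      unfolding very_weak_solution_def
    proof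
      fix i
      define u'' where "u'' t = a i * (- (2 * (\<delta> * lam i powr (1 - \<alpha>))) * v' i t - c t * (lam i)\<^sup>2 * v i t)" for t
      have sol: "sine_like_solution (2 * (\<delta> * lam i powr (1 - \<alpha>))) (\<lambda>t. c t * (lam i)\<^sup>2) (v i) (v' i)"
        using v[of i] by (simp add: fundamental_def)
      have "continuous_on {0..} u''" unfolding u''_def
        by (intro continuous_intros sine_like_solution_continuous[OF sol] PS_continuous_on[OF c \<alpha>(1)])
      moreover have "(u i has_real_derivative u' i t) (at t within {0..})"
        "(u' i has_real_derivative u'' t) (at t within {0..})" if "0 \<le> t" for t
        using sol that unfolding sine_like_solution_def u_def u'_def u''_def by (auto intro!: DERIV_cmult)
      moreover have "u'' t + 2 * \<delta> * lam i powr (2 * \<sigma>) * u' i t + c t * (lam i)\<^sup>2 * u i t = 0" for t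
        unfolding assms(9) by (simp add: u''_def u'_def u_def algebra_simps)
      ultimately show "\<exists>u''. continuous_on {0..} u'' \<and>
        (\<forall>t\<ge>0. (u i has_real_derivative u' i t) (at t within {0..}) \<and>
                (u' i has_real_derivative u'' t) (at t within {0..}) \<and>
                u'' t + 2 * \<delta> * lam i powr (2 * \<sigma>) * u' i t + c t * (lam i)\<^sup>2 * u i t = 0)" by blast
    qed
    moreover have "(\<lambda>i. u i 0) \<in> G_pos lam s (1/2)"
      by (simp add: G_pos_def u_def v_0)
    moreover have "(\<lambda>i. u' i 0) \<in> G_pos lam s 0"
    proof -
      \<comment> \<open>A nonzero base is needed for \<open>powr 0\<close> to equal 1, because
        \<open>0 powr 0 = 0\<close>.\<close>
      have "1 + lam i \<noteq> 0" for i using lam_nonneg[of i] by simp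
      then have eq: "(u' i 0)\<^sup>2 * (1 + lam i) powr (4 * 0) * exp (2 * lam i powr (1 / s) / ln (2 + lam i))
          = (a i)\<^sup>2 * exp (2 * X i)" for i
        using assms(10) by (simp add: u'_def v_0 X_def)
      have "(a (j k))\<^sup>2 * exp (2 * X (j k)) = 1 / (real (Suc k))\<^sup>2" for k
      proof -
        have "(a (j k))\<^sup>2 = exp (- (2 * X (j k))) / (real k + 1)\<^sup>2"
          by (simp add: a_j power_divide exp_double[symmetric])
        then show ?thesis by (simp add: exp_minus add.commute)
      qed
      moreover have "summable (\<lambda>k. 1 / (real (Suc k))\<^sup>2)"
        using inverse_power_summable[of 2, where 'a=real] summable_Suc_iff[of "\<lambda>n. inverse ((real n)\<^sup>2)"]
        by (simp add: inverse_eq_divide)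
      ultimately have "summable ((\<lambda>i. (a i)\<^sup>2 * exp (2 * X i)) \<circ> j)" by (simp add: o_def)
      then have "summable (\<lambda>i. (a i)\<^sup>2 * exp (2 * X i))"
        using summable_mono_reindex[OF j, of "\<lambda>i. (a i)\<^sup>2 * exp (2 * X i)"] by (simp add: a_def o_def)
      then show ?thesis unfolding G_pos_def by (simp only: mem_Collect_eq eq)
    qed
    moreover have "\<not> ((\<lambda>i. u i t) \<in> G_neg lam S (1/2) \<and> (\<lambda>i. u' i t) \<in> G_neg lam S 0)" if t: "0 < t" for t
    proof
      assume G: "(\<lambda>i. u i t) \<in> G_neg lam S (1/2) \<and> (\<lambda>i. u' i t) \<in> G_neg lam S 0"
      \<comment> \<open>The growth concerns \<open>u\<^sup>2 + u'\<^sup>2\<close> and does not tell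
        which component is large, so the two series are added. Their terms tend to 0, yet one beyond
        \<open>N\<close> will be at least 1.\<close>
      define f where "f i = (u i t)\<^sup>2 * (1 + lam i) powr 2 * exp (- 2 * X i) + (u' i t)\<^sup>2 * exp (- 2 * X i)" for i
      have "1 + lam i \<noteq> 0" for i using lam_nonneg[of i] by simp
      then have "summable f" unfolding f_def
        using G assms(11) by (intro summable_add) (simp_all add: G_neg_def X_def)
      then have "f \<longlonglongrightarrow> 0" by (rule summable_LIMSEQ_zero)
      then have "\<forall>\<^sub>F i in sequentially. f i < 1" by (rule order_tendstoD) simp
      then obtain N where N: "\<And>i. N \<le> i \<Longrightarrow> f i < 1" by (auto simp: eventually_sequentially)
      obtain m :: nat where m: "max t (1 / t) \<le> real m" using real_arch_simple by blast
      define n where "n = max N m"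
      have "t \<in> window n"
      proof -
        have "real m \<le> real n" by (simp add: n_def)
        then have "t \<le> real n + 1" "1 / t \<le> real n + 1" using m by auto
        then show ?thesis using t by (simp add: window_def field_simps)
      qed
      then obtain k where k: "n \<le> k" and grow: "\<theta> (j k) < (v (j k) t)\<^sup>2 + (v' (j k) t)\<^sup>2"
        using cU[of n] v unfolding U_def by blast
      define i where "i = j k"
      have "k \<le> i" unfolding i_def using j by (rule strict_mono_imp_increasing)
      then have "f i < 1" using N[of i] k by (simp add: n_def)
      have "(real k + 1)\<^sup>2 \<le> (1 + lam i)\<^sup>2"
        using j_lam[of k] by (intro power_mono) (auto simp: i_def)
      then have "1 \<le> (1 + lam i)\<^sup>2 / (real k + 1)\<^sup>2" by (simp add: divide_simps)
      also have "\<dots> = (a i)\<^sup>2 * exp (- 2 * X i) * \<theta> i"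
      proof -
        have a2: "(a i)\<^sup>2 = exp (- (2 * X i)) / (real k + 1)\<^sup>2"
          by (simp add: i_def a_j power_divide exp_double[symmetric])
        have "(a i)\<^sup>2 * exp (- 2 * X i) * \<theta> i =
            (1 + lam i)\<^sup>2 / (real k + 1)\<^sup>2 * (exp (- (2 * X i)) * exp (- 2 * X i) * exp (4 * X i))"
          unfolding a2 \<theta>_def by simp
        moreover have "exp (- (2 * X i)) * exp (- 2 * X i) * exp (4 * X i) = 1"
          by (simp add: exp_add[symmetric])
        ultimately show ?thesis by (simp only: mult_1_right)
      qed
      also have "\<dots> \<le> (a i)\<^sup>2 * exp (- 2 * X i) * ((v i t)\<^sup>2 * (1 + lam i) powr 2 + (v' i t)\<^sup>2)"
      proof (intro mult_left_mono)
        have "1 \<le> (1 + lam i) powr 2" using lam_nonneg[of i] by (intro ge_one_powr_ge_zero) auto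
        then have "(v i t)\<^sup>2 * 1 \<le> (v i t)\<^sup>2 * (1 + lam i) powr 2" by (intro mult_left_mono) auto
        then show "\<theta> i \<le> (v i t)\<^sup>2 * (1 + lam i) powr 2 + (v' i t)\<^sup>2"
          using grow unfolding i_def by linarith
      qed simp
      also have "\<dots> = f i" by (simp add: f_def u_def u'_def power_mult_distrib algebra_simps)
      finally show False using \<open>f i < 1\<close> by simp
    qed
    ultimately show ?thesis by blast
  qed
  ultimately show ?thesis
    unfolding residual_in_def by (intro conjI exI[of _ U]) (auto simp: U_def)
qed

end
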